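(* Let $\mathcal{L}>0$ and let $\Phi:\mathbb{R}_+\to\mathbb{R}_+$ satisfy all of the following conditions. (1) $\Phi$ is monotonically increasing. (2) $\int_x^\infty \frac{dt}{\Phi(t)}<\infty$ for every $x>0$. (3) For every closed curve $f$ (as in the context) with $\mathcal{E}_\Phi(f)<\infty$, one has $f\in W_\Phi\cap W^{1,\infty}(\mathbb{R}/\mathcal{L}\mathbb{Z})$ and $f$ is bi-Lipschitz. (4) For every bi-Lipschitz $f\in W_\Phi\cap W^{1,\infty}(\mathbb{R}/\mathcal{L}\mathbb{Z})$ with $\|f'\|_{\mathbb{R}^n}=1$ a.e., $$\lim_{\epsilon\to+0}\epsilon\int_{\mathbb{R}/\mathcal{L}\mathbb{Z}}\bigl(\Lambda(\|f(s_1)-f(s_1+\epsilon)\|_{\mathbb{R}^n})-\Lambda(\epsilon)\bigr)\,ds_1=0$$ and $$\lim_{\epsilon\to+0}\int_{\mathbb{R}/\mathcal{L}\mathbb{Z}}\Lambda(\|f(s_1)-f(s_1+\epsilon)\|_{\mathbb{R}^n})\int_{s_1}^{s_1+\epsilon}\|f'(s_1)-f'(s_2)\|_{\mathbb{R}^n}^2\,ds_2\,ds_1=0.$$ Let $f$ be a closed curve (as in the context) with $\mathcal{E}_\Phi(f)<\infty$. Then the principal value integral $$\lim_{\epsilon\to+0}\int_{\mathbb{R}/\mathcal{L}\mathbb{Z}}\left(\int_{s_1-\frac{\mathcal{L}}2+\epsilon}^{s_1-\epsilon}+\int_{s_1+\epsilon}^{s_1+\frac{\mathcal{L}}2-\epsilon}\right)\left(\mathscr{M}_{\Phi,1}(f)+\mathscr{M}_{\Phi,2}(f)\right)ds_2\,ds_1$$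 converges, and $$\mathcal{E}_\Phi(f)=\lim_{\epsilon\to+0}\int_{\mathbb{R}/\mathcal{L}\mathbb{Z}}\left(\int_{s_1-\frac{\mathcal{L}}2+\epsilon}^{s_1-\epsilon}+\int_{s_1+\epsilon}^{s_1+\frac{\mathcal{L}}2-\epsilon}\right)\left(\mathscr{M}_{\Phi,1}(f)+\mathscr{M}_{\Phi,2}(f)\right)ds_2\,ds_1+2\mathcal{L}\int_{\mathcal{L}/2}^\infty\frac{dx}{\Phi(x)}.$$
   Context: $\mathbb{R}_+=\{x\in\mathbb{R}: x>0\}$. A closed curve $f:\mathbb{R}/\mathcal{L}\mathbb{Z}\to\mathbb{R}^n$ here means a closed curve without self-intersections, of total length $\mathcal{L}$, parametrized by arc-length; $\tau=f'$ is its unit tangent vector (defined a.e.). For a function $u$ on $\mathbb{R}/\mathcal{L}\mathbb{Z}$, $\Delta u=u(s_1)-u(s_2)$. $\mathscr{D}(f(s_1),f(s_2))=\mathrm{dist}_{\mathbb{R}/\mathcal{L}\mathbb{Z}}(s_1,s_2)$ is the distance along the curve. The energy is $$\mathcal{E}_\Phi(f)=\iint_{(\mathbb{R}/\mathcal{L}\mathbb{Z})^2}\left(\frac{1}{\Phi(\|f(s_1)-f(s_2)\|_{\mathbb{R}^n})}-\frac{1}{\Phi(\mathscr{D}(f(s_1),f(s_2)))}\right)ds_1ds_2.$$ $$W_\Phi=\left\{u\in W^{1,2}(\mathbb{R}/\mathcal{L}\mathbb{Z};\mathbb{R}^n)\ :\ \iint_{(\mathbb{R}/\mathcal{L}\mathbb{Z})^2}\frac{\|\Delta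 u'\|_{\mathbb{R}^n}^2}{\Phi(\mathrm{dist}_{\mathbb{R}/\mathcal{L}\mathbb{Z}}(s_1,s_2))}\,ds_1ds_2<\infty\right\}.$$ $\Lambda(x)=-\frac1x\int_x^\infty\frac{dt}{\Phi(t)}$ for $x>0$. Bi-Lipschitz means there are constants $c,C>0$ with $c\,\mathrm{dist}_{\mathbb{R}/\mathcal{L}\mathbb{Z}}(s_1,s_2)\le\|f(s_1)-f(s_2)\|_{\mathbb{R}^n}\le C\,\mathrm{dist}_{\mathbb{R}/\mathcal{L}\mathbb{Z}}(s_1,s_2)$ for all $s_1,s_2$. The densities (functions of $(s_1,s_2)$) are $$\mathscr{M}_{\Phi,1}(f)=\frac{\|\Delta\tau\|_{\mathbb{R}^n}^2}{2\Phi(\|\Delta f\|_{\mathbb{R}^n})},\qquad \mathscr{M}_{\Phi,2}(f)=\left(\frac{1}{\Phi(\|\Delta f\|_{\mathbb{R}^n})}-\Lambda(\|\Delta f\|_{\mathbb{R}^n})\right)\left\langle\tau(s_1)\wedge\frac{\Delta f}{\|\Delta f\|_{\mathbb{R}^n}},\ \tau(s_2)\wedge\frac{\Delta f}{\|\Delta f\|_{\mathbb{R}^n}}\right\rangle_{\bigwedge^2\mathbb{R}^n},$$ where $\langle a\wedge b,c\wedge d\rangle_{\bigwedge^2\mathbb{R}^n}=(a\cdot c)(b\cdot d)-(a\cdot d)(b\cdot c)$. *)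

theory Defs
  imports "HOL-Analysis.Analysis"
begin

text \<open>
  Functions on the circle of circumference \<open>L\<close> are represented by \<open>L\<close>-periodic functions on the
  real line, and integrals over the circle by integrals over \<open>{0..L}\<close>.
\<close>

definition periodic :: "real \<Rightarrow> (real \<Rightarrow> 'a) \<Rightarrow> bool" where
  "periodic L u \<longleftrightarrow> (\<forall>s. u (s + L) = u s)"

definition circle_dist :: "real \<Rightarrow> real \<Rightarrow> real \<Rightarrow> real" where
  "circle_dist L s t = (INF k::int. \<bar>s - t + of_int k * L\<bar>)"

definition curve_length :: "(real \<Rightarrow> 'a::metric_space) \<Rightarrow> real \<Rightarrow> real \<Rightarrow> ennreal" where
  "curve_length f a b =
    (SUP ts \<in> {ts. sorted ts \<and> set ts \<subseteq> {a..b}}.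
       \<Sum>i<length ts - 1. ennreal (dist (f (ts ! i)) (f (ts ! Suc i))))"

text \<open>
  Since \<open>s\<close> is the arc-length parameter, the total length of one period is \<open>L\<close>.
\<close>

definition simple_closed_arclength_curve :: "real \<Rightarrow> (real \<Rightarrow> real ^ 'n) \<Rightarrow> bool" where
  "simple_closed_arclength_curve L f \<longleftrightarrow>
     periodic L f \<and> continuous_on UNIV f \<and> inj_on f {0..<L} \<and>
     (\<forall>a b. a \<le> b \<longrightarrow> curve_length f a b = ennreal (b - a))"

definition bi_Lipschitz :: "real \<Rightarrow> (real \<Rightarrow> real ^ 'n) \<Rightarrow> bool" where
  "bi_Lipschitz L f \<longleftrightarrow>
     (\<exists>c C. c > 0 \<and> C > 0 \<and>
        (\<forall>s\<^sub>1 s\<^sub>2. c * circle_dist L s\<^sub>1 s\<^sub>2 \<le> norm (f s\<^sub>1 - f s\<^sub>2) \<and>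
                 norm (f s\<^sub>1 - f s\<^sub>2) \<le> C * circle_dist L s\<^sub>1 s\<^sub>2))"

text \<open>
  For monotone \<open>\<Phi>\<close> the integrand is nonnegative off the diagonal, because a chord is never longer
  than the arc it subtends; hence the truncation of negative values by \<^const>\<open>ennreal\<close> has no
  effect. The value of \<open>\<Phi>\<close> at \<open>0\<close> is used on a null set only.
\<close>

definition energy :: "real \<Rightarrow> (real \<Rightarrow> real) \<Rightarrow> (real \<Rightarrow> real ^ 'n) \<Rightarrow> ennreal" where
  "energy L \<Phi> f =
     (\<integral>\<^sup>+ (s\<^sub>1, s\<^sub>2) \<in> {0..L} \<times> {0..L}.
        ennreal (1 / \<Phi> (norm (f s\<^sub>1 - f s\<^sub>2)) - 1 / \<Phi> (circle_dist L s\<^sub>1 s\<^sub>2)) \<partial>lebesgue)"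

subsection \<open>Sobolev spaces on the circle\<close>

definition test_function :: "real \<Rightarrow> (real \<Rightarrow> real) \<Rightarrow> bool" where
  "test_function L \<phi> \<longleftrightarrow>
     periodic L \<phi> \<and> (\<forall>k x. (deriv ^^ k) \<phi> field_differentiable (at x))"

definition has_weak_derivative ::
    "real \<Rightarrow> (real \<Rightarrow> real ^ 'n) \<Rightarrow> (real \<Rightarrow> real ^ 'n) \<Rightarrow> bool" where
  "has_weak_derivative L u g \<longleftrightarrow>
     periodic L u \<and> periodic L g \<and>
     set_integrable lebesgue {0..L} u \<and> set_integrable lebesgue {0..L} g \<and>
     (\<forall>\<phi>. test_function L \<phi> \<longrightarrow>
        (LINT s:{0..L}|lebesgue. deriv \<phi> s *\<^sub>R u s) = - (LINT s:{0..L}|lebesgue. \<phi> s *\<^sub>R g s))"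

definition L_two :: "real \<Rightarrow> (real \<Rightarrow> real ^ 'n) set" where
  "L_two L = {u. periodic L u \<and> u \<in> borel_measurable lebesgue \<and>
                 set_integrable lebesgue {0..L} (\<lambda>s. (norm (u s))\<^sup>2)}"

definition L_infinity :: "real \<Rightarrow> (real \<Rightarrow> real ^ 'n) set" where
  "L_infinity L = {u. periodic L u \<and> u \<in> borel_measurable lebesgue \<and>
                      (\<exists>B. AE s in lebesgue. norm (u s) \<le> B)}"

definition W_one_infinity :: "real \<Rightarrow> (real \<Rightarrow> real ^ 'n) set" where
  "W_one_infinity L =
     {u \<in> L_infinity L. \<exists>u'. has_weak_derivative L u u' \<and> u' \<in> L_infinity L}"

text \<open>
  The first two conditions on \<open>u'\<close> say that \<open>u\<close> lies in \<open>W\<^sup>1\<^sup>,\<^sup>2\<close>. The weak derivative is unique up to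
  null sets, so the choice of \<open>u'\<close> does not matter for the double integral.
\<close>

definition W_Phi :: "real \<Rightarrow> (real \<Rightarrow> real) \<Rightarrow> (real \<Rightarrow> real ^ 'n) set" where
  "W_Phi L \<Phi> =
     {u \<in> L_two L. \<exists>u'. has_weak_derivative L u u' \<and> u' \<in> L_two L \<and>
        (\<integral>\<^sup>+ (s\<^sub>1, s\<^sub>2) \<in> {0..L} \<times> {0..L}.
           ennreal ((norm (u' s\<^sub>1 - u' s\<^sub>2))\<^sup>2 / \<Phi> (circle_dist L s\<^sub>1 s\<^sub>2)) \<partial>lebesgue) < \<infinity>}"

subsection \<open>Energy densities\<close>

text \<open>
  The pointwise derivative, which for Lipschitz curves exists almost everywhere and agrees almost
  everywhere with the weak one. Where it does not exist, the value is unspecified.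
\<close>

definition tangent :: "(real \<Rightarrow> real ^ 'n) \<Rightarrow> real \<Rightarrow> real ^ 'n" where
  "tangent f s = vector_derivative f (at s)"

definition Lambda :: "(real \<Rightarrow> real) \<Rightarrow> real \<Rightarrow> real" where
  "Lambda \<Phi> x = - (1 / x) * (LINT t:{x..}|lebesgue. 1 / \<Phi> t)"

definition wedge_inner :: "real ^ 'n \<Rightarrow> real ^ 'n \<Rightarrow> real ^ 'n \<Rightarrow> real ^ 'n \<Rightarrow> real" where
  \<comment> \<open>inner product of the bivectors \<open>a \<and> b\<close> and \<open>c \<and> d\<close>\<close>
  "wedge_inner a b c d = (a \<bullet> c) * (b \<bullet> d) - (a \<bullet> d) * (b \<bullet> c)"

definition M1 :: "(real \<Rightarrow> real) \<Rightarrow> (real \<Rightarrow> real ^ 'n) \<Rightarrow> real \<Rightarrow> real \<Rightarrow> real" where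
  "M1 \<Phi> f s\<^sub>1 s\<^sub>2 = (norm (tangent f s\<^sub>1 - tangent f s\<^sub>2))\<^sup>2 / (2 * \<Phi> (norm (f s\<^sub>1 - f s\<^sub>2)))"

definition M2 :: "(real \<Rightarrow> real) \<Rightarrow> (real \<Rightarrow> real ^ 'n) \<Rightarrow> real \<Rightarrow> real \<Rightarrow> real" where
  "M2 \<Phi> f s\<^sub>1 s\<^sub>2 =
     (let r = norm (f s\<^sub>1 - f s\<^sub>2); e = (f s\<^sub>1 - f s\<^sub>2) /\<^sub>R r
      in (1 / \<Phi> r - Lambda \<Phi> r) * wedge_inner (tangent f s\<^sub>1) e (tangent f s\<^sub>2) e)"

definition inner_truncated_integral ::
    "real \<Rightarrow> (real \<Rightarrow> real \<Rightarrow> real) \<Rightarrow> real \<Rightarrow> real \<Rightarrow> real" where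
  "inner_truncated_integral L M \<epsilon> s\<^sub>1 =
     (LINT s\<^sub>2:{s\<^sub>1 - L/2 + \<epsilon>..s\<^sub>1 - \<epsilon>}|lebesgue. M s\<^sub>1 s\<^sub>2) +
     (LINT s\<^sub>2:{s\<^sub>1 + \<epsilon>..s\<^sub>1 + L/2 - \<epsilon>}|lebesgue. M s\<^sub>1 s\<^sub>2)"

definition truncated_integral :: "real \<Rightarrow> (real \<Rightarrow> real \<Rightarrow> real) \<Rightarrow> real \<Rightarrow> real" where
  "truncated_integral L M \<epsilon> = (LINT s\<^sub>1:{0..L}|lebesgue. inner_truncated_integral L M \<epsilon> s\<^sub>1)"

text \<open>
  Bochner integrals of non-integrable functions are \<open>0\<close> by convention, so that the truncated
  integrals exist has to be said separately.
\<close>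

definition truncated_integral_exists :: "real \<Rightarrow> (real \<Rightarrow> real \<Rightarrow> real) \<Rightarrow> real \<Rightarrow> bool" where
  "truncated_integral_exists L M \<epsilon> \<longleftrightarrow>
     (AE s\<^sub>1 in lebesgue.
        set_integrable lebesgue {s\<^sub>1 - L/2 + \<epsilon>..s\<^sub>1 - \<epsilon>} (M s\<^sub>1) \<and>
        set_integrable lebesgue {s\<^sub>1 + \<epsilon>..s\<^sub>1 + L/2 - \<epsilon>} (M s\<^sub>1)) \<and>
     set_integrable lebesgue {0..L} (inner_truncated_integral L M \<epsilon>)"

definition has_principal_value :: "real \<Rightarrow> (real \<Rightarrow> real \<Rightarrow> real) \<Rightarrow> real \<Rightarrow> bool" where
  "has_principal_value L M v \<longleftrightarrow>
     (\<forall>\<^sub>F \<epsilon> in at_right 0. truncated_integral_exists L M \<epsilon>) \<and>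
     (truncated_integral L M \<longlongrightarrow> v) (at_right 0)"

end

theory Submission
  imports Defs
begin

text \<open>
  Write \<open>r\<close> for the length of the chord from \<open>f s\<close> to \<open>f x\<close>
  and \<open>tail y\<close> for the integral of \<open>1 / \<Phi>\<close> over \<open>{y..}\<close>,
  so that \<open>\<Lambda> y = - tail y / y\<close>. The key is that, for a fixed base point
  \<open>s\<close>, the density \<open>M1 + M2\<close> equals \<open>1 / \<Phi> r\<close> plus the
  \<open>x\<close>-derivative of \<open>\<Lambda> r * ((f s - f x) \<bullet> \<tau> s)\<close>
  (lemma \<open>density_integral\<close>). Integrated over a truncated window it therefore gives the
  integral of \<open>1 / \<Phi> r\<close> plus boundary terms at the offsets \<open>\<plusminus>
  e\<close> and \<open>\<plusminus> (L / 2 - e)\<close>.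

  The integral of \<open>1 / \<Phi> r\<close> is compared with the energy: the term that the energy
  subtracts contributes \<open>2 * L * (tail e - tail (L / 2 - e))\<close>, and what is left
  converges to the energy by dominated convergence (\<open>integral_excess_window\<close> and
  \<open>integral_excess_window_tendsto\<close>). So it has to be shown that the boundary terms
  behave like \<open>- 2 * L * tail e\<close>. After integration over \<open>s\<close>, those at
  \<open>h\<close> and \<open>- h\<close> are opposite to each other, because their sum is the
  integral of a derivative over a period (\<open>integral_boundary_minus\<close>). For the offsets
  near \<open>L / 2\<close> this and periodicity make them vanish in the limit
  (\<open>boundary_integral_half_period\<close>). For the offset \<open>e\<close> the expansion
  \<open>\<tau> x \<bullet> \<tau> s = 1 - \<parallel>\<tau> s - \<tau> x\<parallel>\<^sup>2 /
  2\<close> turns the boundary term into exactly the two expressions whose limits are hypotheses,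
  plus the tail at \<open>e\<close> (\<open>first_remainder\<close> and
  \<open>second_remainder\<close>).

  The curve is only Lipschitz and \<open>\<Phi>\<close> may jump, so all derivatives exist merely
  almost everywhere. The first part proves that real Lipschitz functions are differentiable almost
  everywhere and are integrals of their derivatives. The upper Dini derivative is approximated from
  below by upper semicontinuous functions, whose indefinite integrals can be compared with the
  function pointwise. Differentiability, unit speed of arc-length curves and the fundamental theorem
  for the primitives above all follow from this.
\<close>

section \<open>Lipschitz functions are differentiable almost everywhere\<close>

text \<open>
  The points up to which the loss of \<open>F\<close> stays below \<open>e\<close> times the
  distance travelled form a closed set. Its supremum can be pushed further to the right as long as
  it is not \<open>b\<close>.
\<close>

lemma nondecreasing_if_upper_derivative_nonneg:
  fixes F :: "real \<Rightarrow> real"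
  assumes ab: "a \<le> b" and cont: "continuous_on {a..b} F"
    and step: "\<And>x e. \<lbrakk>a \<le> x; x < b; 0 < e\<rbrakk> \<Longrightarrow>
        \<exists>y. x < y \<and> y \<le> b \<and> F x - e * (y - x) \<le> F y"
  shows "F a \<le> F b"
proof -
  have key: "F a - e * (b - a) \<le> F b" if e: "e > 0" for e
  proof -
    define S where "S = {x \<in> {a..b}. F a - e * (x - a) \<le> F x}"
    have "closed S"
      unfolding S_def by (intro continuous_on_closed_Collect_le continuous_intros cont)
    moreover have "a \<in> S" using ab by (auto simp: S_def)
    moreover have bdd: "bdd_above S" by (auto simp: S_def)
    ultimately have cS: "Sup S \<in> S" using closed_contains_Sup[of S] by auto
    have "Sup S = b"
    proof (rule ccontr)
      assume "Sup S \<noteq> b"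
      with cS have c: "a \<le> Sup S" "Sup S < b" by (auto simp: S_def)
      from step[OF this e] obtain y where y: "Sup S < y" "y \<le> b" "F (Sup S) - e * (y - Sup S)
          \<le> F y" by auto
      then have "y \<in> S" using cS c by (auto simp: S_def algebra_simps)
      then show False using y bdd cSup_upper by fastforce
    qed
    then show ?thesis using cS by (simp add: S_def)
  qed
  show ?thesis
  proof (rule field_le_epsilon)
    fix e :: real assume "e > 0"
    have "F a - e / (b - a + 1) * (b - a) \<le> F b"
        using key[of "e / (b - a + 1)"] ab \<open>e > 0\<close> by simp
    moreover have "e / (b - a + 1) * (b - a) \<le> e" using ab \<open>e > 0\<close> by (simp add: field_simps)
    ultimately show "F a \<le> F b + e" by linarith
  qed
qed

text \<open>
  Upper semicontinuity of \<open>l\<close> is what makes its indefinite integral grow, near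
  \<open>x\<close>, no faster than \<open>l x\<close>. So \<open>F\<close> minus that integral still
  has a nonnegative upper derivative at every single point, and no covering argument is needed to
  compare the two.
\<close>

lemma integral_usc_le_increment:
  fixes F l :: "real \<Rightarrow> real"
  assumes ab: "a \<le> b" and cont: "continuous_on {a..b} F" and l: "l integrable_on {a..b}"
    and usc: "\<And>x. \<exists>d>0. \<forall>y. \<bar>y - x\<bar> < d \<longrightarrow> l y \<le> l x"
    and upper: "\<And>x e d. \<lbrakk>0 < e; 0 < d\<rbrakk> \<Longrightarrow>
        \<exists>h. 0 < h \<and> h < d \<and> (l x - e) * h \<le> F (x + h) - F x"
  shows "integral {a..b} l \<le> F b - F a"
proof -
  define G where "G x = F x - integral {a..x} l" for x
  have "G a \<le> G b"
  proof (rule nondecreasing_if_upper_derivative_nonneg[OF ab])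
    show "continuous_on {a..b} G"
      unfolding G_def by (intro continuous_intros cont indefinite_integral_continuous_1 l)
  next
    fix x e :: real assume x: "a \<le> x" "x < b" and e: "0 < e"
    obtain d where d: "d > 0" "\<And>y. \<bar>y - x\<bar> < d \<Longrightarrow> l y \<le> l x"
        using usc[of x] by auto
    obtain h where h: "0 < h" "h < min d (b - x)" "(l x - e) * h \<le> F (x + h) - F x"
      using upper[OF e, of "min d (b - x)" x] d x by auto
    have int: "l integrable_on {x..x+h}" "l integrable_on {a..x+h}"
      using x h by (auto intro!: integrable_subinterval_real[OF l])
    have "integral {a..x} l + integral {x..x+h} l = integral {a..x+h} l"
      using x h int by (intro Henstock_Kurzweil_Integration.integral_combine) auto
    moreover have "integral {x..x+h} l \<le> integral {x..x+h} (\<lambda>_. l x)"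
      using int h by (intro integral_le) (auto intro!: d)
    ultimately have "G (x + h) - G x \<ge> F (x + h) - F x - h * l x"
      using h by (simp add: G_def)
    then have "G x - e * h \<le> G (x + h)" using h(3) by (simp add: algebra_simps)
    then show "\<exists>y. x < y \<and> y \<le> b \<and> G x - e * (y - x) \<le> G y"
      using h by (intro exI[of _ "x + h"]) auto
  qed
  then show ?thesis by (simp add: G_def)
qed

lemma bounded_borel_set_integrable:
  fixes u :: "real \<Rightarrow> real"
  assumes "u \<in> borel_measurable borel" "\<And>x. \<bar>u x\<bar> \<le> B"
  shows "set_integrable lborel {a..b} u"
proof (rule set_integrable_bound)
  show "set_integrable lborel {a..b} (\<lambda>_. B)"
    unfolding set_integrable_def by (intro integrable_scaleR_left integrable_real_indicator) (auto simp:
        emeasure_lborel_Icc_eq)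
  show "set_borel_measurable lborel {a..b} u" using assms(1) by (auto simp: set_borel_measurable_def)
  show "AE x in lborel. x \<in> {a..b} \<longrightarrow> norm (u x) \<le> norm B"
    using assms(2) by (auto intro!: AE_I2 intro: order_trans[OF _ abs_ge_self])
qed

lemma bounded_borel_integrable_on:
  fixes u :: "real \<Rightarrow> real"
  assumes "u \<in> borel_measurable borel" "\<And>x. \<bar>u x\<bar> \<le> B"
  shows "u integrable_on {a..b}"
  using set_borel_integral_eq_integral(1)[OF bounded_borel_set_integrable[OF assms]] .

text \<open>
  One half of the Vitali-Caratheodory theorem. Rounding \<open>u\<close> down to a multiple of
  \<open>\<delta>\<close> gives a finite sum of indicators of superlevel sets. Shrinking these to
  closed sets \<open>K i\<close> makes every indicator upper semicontinuous and costs arbitrarily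
  little measure.
\<close>

lemma usc_minorant:
  fixes u :: "real \<Rightarrow> real"
  assumes u[measurable]: "u \<in> borel_measurable borel" and u0: "\<And>x. 0
      \<le> u x" and uB: "\<And>x. u x \<le> B"
    and \<eta>: "\<eta> > 0" and ab: "a \<le> b"
  shows "\<exists>l. l integrable_on {a..b} \<and> (\<forall>x. l x \<le> u x) \<and>
             (\<forall>x. \<exists>d>0. \<forall>y. \<bar>y - x\<bar> < d \<longrightarrow> l y
                 \<le> l x) \<and>
             integral {a..b} u \<le> integral {a..b} l + \<eta>"
proof -
  have B0: "0 \<le> B" using u0[of 0] uB[of 0] by linarith
  define \<delta> where "\<delta> = \<eta> / (2 * (b - a + 1))"
  have \<delta>: "\<delta> > 0" "\<delta> * (b - a) \<le> \<eta> / 2" using \<eta> ab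
      by (auto simp: \<delta>_def field_simps)
  obtain m :: nat where m: "B \<le> real m * \<delta>" using \<delta>(1) reals_Archimedean3
      by (metis less_imp_le)
  define \<kappa> where "\<kappa> = \<eta> / (2 * (real m * \<delta> + 1))"
  have m0: "0 \<le> real m * \<delta>" using \<delta> by simp
  have \<kappa>: "\<kappa> > 0" using \<eta> m0 by (simp add: \<kappa>_def)
  have m\<kappa>: "real m * \<delta> * \<kappa> \<le> \<eta> / 2" using \<eta> m0
      by (simp add: \<kappa>_def divide_simps)
  define A where "A i = {x. (real i + 1) * \<delta> \<le> u x}" for i :: nat
  have A[measurable]: "A i \<in> sets borel" for i unfolding A_def by measurable
  have "\<exists>T. closed T \<and> T \<subseteq> A i \<and> emeasure lebesgue (A i
      - T) < ennreal \<kappa>" for i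
    using sets_lebesgue_inner_closed[of "A i" \<kappa>] A \<kappa>
        by (metis sets_completionI_sets sets_lborel)
  then obtain K where K: "\<And>i. closed (K i)" "\<And>i. K i \<subseteq> A i" "\<And>i. emeasure
      lebesgue (A i - K i) < ennreal \<kappa>"
    by metis
  have [measurable]: "K i \<in> sets borel" for i using K(1) by (intro borel_closed)
  define l where "l x = (\<Sum>i<m. \<delta> * indicator (K i) x)" for x
  define v where "v x = (\<Sum>i<m. \<delta> * indicator (A i - K i) x)" for x
  have sumA: "(\<Sum>i<m. \<delta> * indicator (A i) x) \<le> u x \<and> u x - \<delta>
      \<le> (\<Sum>i<m. \<delta> * indicator (A i) x)" for x
  proof -
    define k where "k = nat \<lfloor>u x / \<delta>\<rfloor>"
    have k: "real k \<le> u x / \<delta>" "u x / \<delta> < real k + 1"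
      using u0[of x] \<delta> by (auto simp: k_def)
    have "u x / \<delta> \<le> real m" using uB[of x] m \<delta> by (simp add: field_simps)
    then have km: "k \<le> m" using k by linarith
    have "indicator (A i) x = (if i < k then 1 else 0 :: real)" for i
    proof -
      have "x \<in> A i \<longleftrightarrow> real i + 1 \<le> u x / \<delta>" using \<delta>
          by (simp add: A_def field_simps)
      also have "\<dots> \<longleftrightarrow> i < k" using k by linarith
      finally show ?thesis by (simp add: indicator_def)
    qed
    then have "(\<Sum>i<m. \<delta> * indicator (A i) x)
        = (\<Sum>i<m. if i < k then \<delta> else 0)" by (intro sum.cong) auto
    also have "\<dots> = (\<Sum>i\<in>{..<m} \<inter> {..<k}. \<delta>)" by (subst sum.inter_restrict) auto
    also have "\<dots> = real k * \<delta>" using km by (simp add: Int_absorb1 lessThan_subset_iff)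
    finally show ?thesis using k \<delta> by (simp add: field_simps)
  qed
  have split: "(\<Sum>i<m. \<delta> * indicator (A i) x) = l x + v x" for x
  proof -
    have "indicator (A i) x = indicator (K i) x + (indicator (A i - K i) x :: real)" for i
      using K(2)[of i] by (auto simp: indicator_def)
    then show ?thesis by (simp only: l_def v_def sum.distrib[symmetric] distrib_left[symmetric])
  qed
  have v0: "0 \<le> v x" for x using \<delta> by (auto simp: v_def intro!: sum_nonneg)
  have l0: "0 \<le> l x" for x using \<delta> by (auto simp: l_def intro!: sum_nonneg)
  have lu: "l x \<le> u x" for x using sumA[of x] split[of x] v0[of x] by linarith
  have vB: "v x \<le> B" for x using sumA[of x] split[of x] l0[of x] uB[of x] by linarith
  have [measurable]: "l \<in> borel_measurable borel" "v \<in> borel_measurable borel"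
    unfolding l_def v_def by measurable
  have li: "l integrable_on {a..b}"
    by (rule bounded_borel_integrable_on[where B=B]) (use l0 lu uB order_trans in \<open>auto simp:
        abs_le_iff intro: order_trans\<close>)
  have vi: "v integrable_on {a..b}"
    by (rule bounded_borel_integrable_on[where B=B]) (use v0 vB in \<open>auto simp: abs_le_iff intro:
        order_trans\<close>)
  have ui: "u integrable_on {a..b}"
    by (rule bounded_borel_integrable_on[where B=B]) (use u0 uB in \<open>auto simp: abs_le_iff intro:
        order_trans\<close>)
  have "(LINT x:{a..b}|lborel. v x) \<le> real m * \<delta> * \<kappa>"
  proof -
    have fin: "emeasure lborel (A i - K i) < ennreal \<kappa>" for i
      using K(3)[of i] by simp
    have "(LINT x:{a..b}|lborel. v x) = (\<Sum>i<m. \<delta> * measure lborel ((A i - K i) \<inter> {a..b}))"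
    proof -
      have "(LINT x:{a..b}|lborel. v x) = (LINT x|lborel. (\<Sum>i<m. \<delta> * indicator ((A i
          - K i) \<inter> {a..b}) x))"
        unfolding set_lebesgue_integral_def v_def
        by (intro Bochner_Integration.integral_cong refl) (auto simp: sum_distrib_left indicator_def)
      also have "\<dots> = (\<Sum>i<m. (LINT x|lborel. \<delta> * indicator ((A i - K i) \<inter> {a..b}) x))"
      proof (intro Bochner_Integration.integral_sum integrable_mult_right integrable_real_indicator)
        fix i
        have "emeasure lborel ((A i - K i) \<inter> {a..b}) \<le> emeasure lborel (A i - K i)"
          by (intro emeasure_mono) auto
        also have "\<dots> < \<infinity>" using fin[of i] by (simp add: less_top order_less_trans)
        finally show "emeasure lborel ((A i - K i) \<inter> {a..b}) < \<infinity>" .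
      qed auto
      finally show ?thesis by simp
    qed
    also have "\<dots> \<le> (\<Sum>i<m. \<delta> * \<kappa>)"
    proof (intro sum_mono mult_left_mono)
      fix i
      have "emeasure lborel ((A i - K i) \<inter> {a..b}) \<le> emeasure lborel (A i - K i)"
        by (intro emeasure_mono) auto
      also have "\<dots> \<le> ennreal \<kappa>" using fin[of i] by simp
      finally show "measure lborel ((A i - K i) \<inter> {a..b}) \<le> \<kappa>"
        using \<kappa> by (simp add: measure_def enn2real_leI)
    qed (use \<delta> in auto)
    finally show ?thesis by simp
  qed
  moreover have "(LINT x:{a..b}|lborel. v x) = integral {a..b} v"
    by (intro set_borel_integral_eq_integral(2) bounded_borel_set_integrable[where B=B])
      (use v0 vB in \<open>auto simp: abs_le_iff intro: order_trans\<close>)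
  ultimately have iv: "integral {a..b} v \<le> \<eta> / 2" using m\<kappa> by linarith
  have "integral {a..b} u \<le> integral {a..b} (\<lambda>x. l x + v x + \<delta>)"
    using sumA split by (intro integral_le ui integrable_add li vi) (auto simp: algebra_simps)
  also have "\<dots> = integral {a..b} l + integral {a..b} v + \<delta> * (b - a)"
    using ab Henstock_Kurzweil_Integration.integral_add[OF li vi]
      Henstock_Kurzweil_Integration.integral_add[OF integrable_add[OF li vi] integrable_const_ivl] by simp
  finally have "integral {a..b} u \<le> integral {a..b} l + \<eta>" using iv \<delta> by linarith
  moreover have "\<exists>d>0. \<forall>y. \<bar>y - x\<bar> < d \<longrightarrow> l y \<le> l x" for x
  proof -
    have "open (- \<Union>(K ` {i\<in>{..<m}. x \<notin> K i}))" using K(1)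
        by (intro open_Compl closed_Union) auto
    moreover have "x \<in> - \<Union>(K ` {i\<in>{..<m}. x \<notin> K i})" by auto
    ultimately obtain d where d: "d > 0" "ball x d \<subseteq> - \<Union>(K ` {i\<in>{..<m}. x \<notin> K i})"
      by (meson open_contains_ball)
    have "l y \<le> l x" if "\<bar>y - x\<bar> < d" for y
    proof -
      have "y \<in> ball x d" using that by (simp add: dist_real_def)
      then have "y \<notin> K i" if "i < m" "x \<notin> K i" for i using d(2) that by auto
      then show ?thesis unfolding l_def using \<delta>
        by (intro sum_mono mult_left_mono) (auto simp: indicator_def)
    qed
    then show ?thesis using d(1) by auto
  qed
  ultimately show ?thesis using li lu by blast
qed

text \<open>
  The upper Dini derivative, that is the limit superior of the right difference quotients. As an
  infimum over countably many suprema of continuous functions it is visibly Borel measurable.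
\<close>

definition upper_right_derivative :: "(real \<Rightarrow> real) \<Rightarrow> real \<Rightarrow> real" where
  "upper_right_derivative F x = (INF n. SUP h\<in>{0<..<1 / (real n + 1)}. (F (x + h) - F x) / h)"

context
  fixes F :: "real \<Rightarrow> real" and C :: real
  assumes lip: "C-lipschitz_on UNIV F"
begin

lemma difference_quotient_bounds:
  assumes "h > 0"
  shows "(F (x + h) - F x) / h \<le> C" "- C \<le> (F (x + h) - F x) / h"
proof -
  have "\<bar>F (x + h) - F x\<bar> \<le> C * h" using lipschitz_onD[OF lip, of "x + h" x] assms
      by (simp add: dist_real_def)
  then show "(F (x + h) - F x) / h \<le> C" "- C \<le> (F (x + h) - F x) / h"
    using assms by (auto simp: field_simps abs_le_iff)
qed

lemma upper_quotient_bounds: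
  fixes n :: nat
  shows "bdd_above ((\<lambda>h. (F (x + h) - F x) / h) ` {0<..<1 / (real n + 1)})"
    and "- C \<le> (SUP h\<in>{0<..<1 / (real n + 1)}. (F (x + h) - F x) / h)"
    and "(SUP h\<in>{0<..<1 / (real n + 1)}. (F (x + h) - F x) / h) \<le> C"
proof -
  have ne: "1 / (2 * (real n + 1)) \<in> {0<..<1 / (real n + 1)}" by (auto simp: field_simps)
  show bdd: "bdd_above ((\<lambda>h. (F (x + h) - F x) / h) ` {0<..<1 / (real n + 1)})"
    using difference_quotient_bounds(1) by (intro bdd_aboveI2[where M=C]) auto
  show "- C \<le> (SUP h\<in>{0<..<1 / (real n + 1)}. (F (x + h) - F x) / h)"
    by (rule cSUP_upper2[OF bdd ne difference_quotient_bounds(2)]) simp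
  show "(SUP h\<in>{0<..<1 / (real n + 1)}. (F (x + h) - F x) / h) \<le> C"
    using ne difference_quotient_bounds(1) by (intro cSUP_least) auto
qed

lemma bdd_below_upper_quotients:
  "bdd_below (range (\<lambda>n. SUP h\<in>{0<..<1 / (real n + 1)}. (F (x + h) - F x) / h))"
  using upper_quotient_bounds(2) by (intro bdd_belowI2[where m="-C"]) auto

lemma abs_upper_right_derivative_le: "\<bar>upper_right_derivative F x\<bar> \<le> C"
proof -
  have "upper_right_derivative F x \<le> C"
    unfolding upper_right_derivative_def
    by (rule cINF_lower2[OF bdd_below_upper_quotients _ upper_quotient_bounds(3)]) auto
  moreover have "- C \<le> upper_right_derivative F x"
    unfolding upper_right_derivative_def using upper_quotient_bounds(2) by (intro cINF_greatest) auto
  ultimately show ?thesis by simp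
qed

lemma upper_right_derivative_attained:
  assumes e: "0 < e" and d: "0 < d"
  shows "\<exists>h. 0 < h \<and> h < d \<and> (upper_right_derivative F x - e) * h \<le> F (x + h) - F x"
proof -
  obtain n :: nat where n: "1 / (real n + 1) < d"
    using d reals_Archimedean[of d] by (auto simp: inverse_eq_divide add.commute)
  have "upper_right_derivative F x \<le> (SUP h\<in>{0<..<1 / (real n + 1)}. (F (x + h) - F x) / h)"
    unfolding upper_right_derivative_def by (intro cINF_lower bdd_below_upper_quotients) auto
  then have "upper_right_derivative F x - e < (SUP h\<in>{0<..<1 / (real n + 1)}. (F (x + h) - F x) / h)"
    using e by simp
  moreover have "{0<..<1 / (real n + 1)} \<noteq> {}" by simp
  ultimately obtain h where "h \<in> {0<..<1 / (real n + 1)}" "upper_right_derivative F x - e < (F (x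
      + h) - F x) / h"
    using less_cSUP_iff[OF _ upper_quotient_bounds(1)] by blast
  moreover from this have "h < d" using n by simp
  ultimately show ?thesis by (intro exI[of _ h]) (auto simp: field_simps)
qed

lemma eventually_quotient_less_upper:
  assumes "upper_right_derivative F x < c"
  shows "\<forall>\<^sub>F h in at_right 0. (F (x + h) - F x) / h < c"
proof -
  obtain n where n: "(SUP h\<in>{0<..<1 / (real n + 1)}. (F (x + h) - F x) / h) < c"
    using assms cINF_less_iff[OF _ bdd_below_upper_quotients] unfolding upper_right_derivative_def by blast
  have "(F (x + h) - F x) / h < c" if "h \<in> {0<..<1 / (real n + 1)}" for h
    using cSUP_upper[OF that upper_quotient_bounds(1)[of x n]] n by simp
  moreover have "0 < 1 / (real n + 1)" by simp
  ultimately show ?thesis unfolding eventually_at_right_field by (metis greaterThanLessThan_iff)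
qed

lemma upper_right_derivative_measurable: "upper_right_derivative F \<in> borel_measurable borel"
proof -
  have cF: "continuous_on UNIV F" using lip by (rule lipschitz_on_continuous_on)
  have "(\<lambda>x. SUP h\<in>{0<..<1 / (real n + 1)}. (F (x
      + h) - F x) / h) \<in> borel_measurable borel" for n :: nat
  proof (rule borel_measurableI_greater)
    fix y
    have ne: "{0<..<1 / (real n + 1)} \<noteq> {}" by simp
    have "{x \<in> space borel. y < (SUP h\<in>{0<..<1 / (real n + 1)}. (F (x + h) - F x) / h)}
        = (\<Union>h\<in>{0<..<1 / (real n + 1)}. {x. y < (F (x + h) - F x) / h})"
      using less_cSUP_iff[OF ne upper_quotient_bounds(1)] by auto
    moreover have "open \<dots>"
      by (intro open_UN ballI open_Collect_less continuous_intros continuous_on_compose2[OF cF]) auto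
    ultimately show "{x \<in> space borel. y < (SUP h\<in>{0<..<1 / (real n + 1)}. (F (x
        + h) - F x) / h)} \<in> sets borel"
      by simp
  qed
  then show ?thesis
    unfolding upper_right_derivative_def[abs_def]
    by (intro borel_measurable_cINF bdd_below_upper_quotients) auto
qed

text \<open>
  This is the direction that the reverse Fatou lemma does not give. Adding \<open>C * x\<close> to
  \<open>F\<close> makes the upper derivative nonnegative, so that it has upper semicontinuous
  minorants.
\<close>

lemma integral_upper_right_derivative_le:
  assumes ab: "a \<le> b"
  shows "integral {a..b} (upper_right_derivative F) \<le> F b - F a"
proof -
  let ?u = "\<lambda>x. upper_right_derivative F x + C"
  have [measurable]: "upper_right_derivative F \<in> borel_measurable borel"
      by (rule upper_right_derivative_measurable)
  have Di: "upper_right_derivative F integrable_on {a..b}"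
    by (rule bounded_borel_integrable_on[OF upper_right_derivative_measurable abs_upper_right_derivative_le])
  have "integral {a..b} ?u \<le> (F b + C * b) - (F a + C * a)"
  proof (rule field_le_epsilon)
    fix \<eta> :: real assume \<eta>: "\<eta> > 0"
    have "\<exists>l. l integrable_on {a..b} \<and> (\<forall>x. l x \<le> ?u x) \<and>
             (\<forall>x. \<exists>d>0. \<forall>y. \<bar>y - x\<bar> < d \<longrightarrow> l y
                 \<le> l x) \<and>
             integral {a..b} ?u \<le> integral {a..b} l + \<eta>"
    proof (rule usc_minorant[OF _ _ _ \<eta> ab])
      show "0 \<le> ?u x" "?u x \<le> C + C" for x using abs_upper_right_derivative_le[of x] by auto
    qed measurable
    then obtain l where l: "l integrable_on {a..b}" "\<And>x. l x \<le> ?u x"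
      "\<And>x. \<exists>d>0. \<forall>y. \<bar>y - x\<bar> < d \<longrightarrow> l y
          \<le> l x" "integral {a..b} ?u \<le> integral {a..b} l + \<eta>" by blast
    have "integral {a..b} l \<le> (F b + C * b) - (F a + C * a)"
    proof (rule integral_usc_le_increment[OF ab _ l(1,3)])
      show "continuous_on {a..b} (\<lambda>x. F x + C * x)"
        using lipschitz_on_continuous_on[OF lip]
            by (intro continuous_intros) (auto intro: continuous_on_subset)
    next
      fix x e d :: real assume "0 < e" "0 < d"
      then obtain h where h: "0 < h" "h < d" "(upper_right_derivative F x - e) * h \<le> F (x + h) - F x"
        using upper_right_derivative_attained by blast
      have "(l x - e) * h \<le> (?u x - e) * h" using h(1) l(2)[of x] by (intro mult_right_mono) auto
      also have "\<dots> \<le> F (x + h) + C * (x + h) - (F x + C * x)" using h(3)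
          by (simp add: algebra_simps)
      finally show "\<exists>h. 0 < h \<and> h < d \<and> (l x - e) * h
          \<le> F (x + h) + C * (x + h) - (F x + C * x)"
        using h by blast
    qed
    then show "integral {a..b} ?u \<le> (F b + C * b) - (F a + C * a) + \<eta>" using l(4) by simp
  qed
  moreover have "integral {a..b} ?u = integral {a..b} (upper_right_derivative F) + C * (b - a)"
    using ab Henstock_Kurzweil_Integration.integral_add[OF Di integrable_const_ivl] by simp
  ultimately show ?thesis by (simp add: algebra_simps)
qed

end

text \<open>
  The upper derivatives \<open>g\<close> of \<open>F\<close> and \<open>k\<close> of \<open>-
  F\<close> satisfy \<open>0 \<le> g + k\<close>, since \<open>- k\<close> is the lower derivative
  of \<open>F\<close>. But the sum of their integrals over an interval is at most \<open>0\<close>.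
  Hence \<open>k = - g\<close> almost everywhere, and both integral inequalities are equalities.
\<close>

lemma lipschitz_right_derivative:
  fixes F :: "real \<Rightarrow> real"
  assumes lip: "C-lipschitz_on UNIV F"
  shows "\<exists>g. g \<in> borel_measurable borel \<and> (\<forall>x. \<bar>g x\<bar> \<le> C) \<and>
    (\<forall>a b. a \<le> b \<longrightarrow> integral {a..b} g = F b - F a) \<and>
    (AE x in lborel. ((\<lambda>h. (F (x + h) - F x) / h) \<longlongrightarrow> g x) (at_right 0))"
proof -
  let ?F' = "\<lambda>x. - F x"
  have lip': "C-lipschitz_on UNIV ?F'" using lip by (rule lipschitz_on_minus)
  define g where "g = upper_right_derivative F"
  define k where "k = upper_right_derivative ?F'"
  note gm[measurable] = upper_right_derivative_measurable[OF lip, folded g_def]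
  note km[measurable] = upper_right_derivative_measurable[OF lip', folded k_def]
  have gB: "\<bar>g x\<bar> \<le> C" for x unfolding g_def by (rule abs_upper_right_derivative_le[OF lip])
  have kB: "\<bar>k x\<bar> \<le> C" for x unfolding k_def by (rule abs_upper_right_derivative_le[OF lip'])
  have gi: "g integrable_on {a..b}" for a b by (rule bounded_borel_integrable_on[OF gm gB])
  have ki: "k integrable_on {a..b}" for a b by (rule bounded_borel_integrable_on[OF km kB])
  have gle: "integral {a..b} g \<le> F b - F a" if "a \<le> b" for a b
    using integral_upper_right_derivative_le[OF lip that] by (simp add: g_def)
  have kle: "integral {a..b} k \<le> F a - F b" if "a \<le> b" for a b
    using integral_upper_right_derivative_le[OF lip' that] by (simp add: k_def)
  have gk: "0 \<le> g x + k x" for x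
  proof (rule ccontr)
    assume neg: "\<not> 0 \<le> g x + k x"
    define e where "e = - (g x + k x) / 2"
    have e: "e > 0" using neg by (simp add: e_def)
    have "\<forall>\<^sub>F h in at_right 0. (F (x + h) - F x) / h < g x + e"
      using eventually_quotient_less_upper[OF lip, of x "g x + e"] e by (simp add: g_def)
    moreover have "\<forall>\<^sub>F h in at_right 0. (?F' (x + h) - ?F' x) / h < k x + e"
      using eventually_quotient_less_upper[OF lip', of x "k x + e"] e by (simp add: k_def)
    ultimately have "\<forall>\<^sub>F h :: real in at_right 0. False"
    proof eventually_elim
      case (elim h)
      have "(?F' (x + h) - ?F' x) / h = - ((F (x + h) - F x) / h)" by (simp add: diff_divide_distrib)
      then have "0 < g x + e + (k x + e)" using elim by linarith
      then show False by (simp add: e_def field_simps)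
    qed
    then show False by simp
  qed
  have gk_int: "integral {a..b} (\<lambda>x. g x + k x) = 0" if "a \<le> b" for a b
  proof -
    have "integral {a..b} (\<lambda>x. g x + k x) \<le> 0"
      using gle[OF that] kle[OF that] gi ki by (simp add: Henstock_Kurzweil_Integration.integral_add)
    moreover have "0 \<le> integral {a..b} (\<lambda>x. g x + k x)" using gk
        by (intro integral_nonneg integrable_add gi ki)
    ultimately show ?thesis by simp
  qed
  have eq: "integral {a..b} g = F b - F a" if "a \<le> b" for a b
    using gk_int[OF that] gle[OF that] kle[OF that] gi ki
        by (simp add: Henstock_Kurzweil_Integration.integral_add)
  have "AE x in lborel. x \<in> {- real n..real n} \<longrightarrow> g x + k x = 0" for n :: nat
  proof -
    have si: "set_integrable lborel {- real n..real n} (\<lambda>x. g x + k x)"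
    proof (rule bounded_borel_set_integrable)
      show "\<bar>g x + k x\<bar> \<le> C + C" for x using gB[of x] kB[of x] by linarith
    qed measurable
    have "(LINT x:{- real n..real n}|lborel. g x + k x) = 0"
      using gk_int[of "- real n" "real n"] set_borel_integral_eq_integral(2)[OF si] by simp
    then have "AE x in lborel. indicator {- real n..real n} x * (g x + k x) = 0"
      using si gk unfolding set_integrable_def set_lebesgue_integral_def real_scaleR_def
      by (subst (asm) integral_nonneg_eq_0_iff_AE) (auto simp: )
    then show ?thesis by eventually_elim (auto simp: indicator_def)
  qed
  then have "AE x in lborel. \<forall>n::nat. x \<in> {- real n..real n} \<longrightarrow> g x + k x = 0"
    unfolding AE_all_countable by blast
  then have "AE x in lborel. ((\<lambda>h. (F (x + h) - F x) / h) \<longlongrightarrow> g x) (at_right 0)"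
  proof eventually_elim
    case (elim x)
    obtain n :: nat where "\<bar>x\<bar> \<le> real n" using real_arch_simple by blast
    then have kx: "k x = - g x" using elim by (auto simp: abs_le_iff dest!: spec[of _ n])
    show ?case
    proof (rule order_tendstoI)
      fix c assume "g x < c"
      then show "\<forall>\<^sub>F h in at_right 0. (F (x + h) - F x) / h < c"
        using eventually_quotient_less_upper[OF lip] by (simp add: g_def)
    next
      fix c assume "c < g x"
      then have "upper_right_derivative ?F' x < - c" using kx by (simp add: k_def)
      from eventually_quotient_less_upper[OF lip' this]
      show "\<forall>\<^sub>F h in at_right 0. c < (F (x + h) - F x) / h"
        by eventually_elim (auto simp: diff_divide_distrib)
    qed
  qed
  then show ?thesis using gm gB eq by blast
qed

lemma AE_lborel_affine:
  fixes P :: "real \<Rightarrow> bool"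
  assumes c: "c \<noteq> 0" and P: "AE x in lborel. P x"
  shows "AE x in lborel. P (t + c * x)"
proof -
  obtain N where N: "{x \<in> space lborel. \<not> P x} \<subseteq> N" "emeasure lborel N
      = 0" "N \<in> sets lborel"
    using AE_E[OF P] .
  have [measurable]: "N \<in> sets borel" using N(3) by simp
  have "AE x in lborel. x \<notin> N" using N by (intro AE_I[where N=N]) auto
  then have "AE x in lborel. t + c * x \<notin> N" by (intro AE_borel_affine c) measurable
  then show ?thesis by eventually_elim (use N(1) in auto)
qed

text \<open>
  After adding \<open>C\<close> and cutting off outside a bounded interval, both functions are
  densities of finite measures. These agree on all half-lines, hence everywhere, and a density is
  unique up to a null set.
\<close>

lemma AE_eq_if_interval_integrals_eq:
  fixes g k :: "real \<Rightarrow> real"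
  assumes [measurable]: "g \<in> borel_measurable borel" "k \<in> borel_measurable borel"
    and gB: "\<And>x. \<bar>g x\<bar> \<le> C" and kB: "\<And>x. \<bar>k x\<bar> \<le> C"
    and eq: "\<And>a b. a \<le> b \<Longrightarrow> integral {a..b} g = integral {a..b} k"
  shows "AE x in lborel. g x = k x"
proof -
  have g0: "0 \<le> g x + C" and k0: "0 \<le> k x + C" for x using gB[of x] kB[of x] by linarith+
  have "AE x in lborel. x \<in> {- real n..real n} \<longrightarrow> g x = k x" for n :: nat
  proof -
    let ?d = "\<lambda>u x. ennreal (u x + C) * indicator {- real n..real n} x"
    have tail: "emeasure (density lborel (?d u)) {x<..} = ennreal (if max x (- real n) \<le> real n
        then integral {max x (- real n)..real n} u + C * (real n - max x (- real n)) else 0)"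
      if u[measurable]: "u \<in> borel_measurable borel" and uB: "\<And>x. \<bar>u x\<bar> \<le> C" for u x
    proof -
      have u0: "0 \<le> u y + C" for y using uB[of y] by linarith
      have ui: "u integrable_on {a..b}" for a b by (rule bounded_borel_integrable_on[OF u uB])
      have "emeasure (density lborel (?d u)) {x<..}
          = (\<integral>\<^sup>+y. ?d u y * indicator {x<..} y \<partial>lborel)"
        by (simp add: emeasure_density)
      also have "\<dots> = (\<integral>\<^sup>+y. ennreal (u y
          + C) * indicator {max x (- real n)..real n} y \<partial>lborel)"
        by (intro nn_integral_cong_AE AE_I[where N="{x}"]) (auto simp: indicator_def)
      also have "\<dots> = ennreal (if max x (- real n) \<le> real n
          then integral {max x (- real n)..real n} u + C * (real n - max x (- real n)) else 0)"
      proof (cases "max x (- real n) \<le> real n")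
        case True
        have "((\<lambda>y. u y + C) has_integral (integral {max x (- real n)..real n} u
            + (real n - max x (- real n)) *\<^sub>R C))
            {max x (- real n)..real n}"
          using True has_integral_const_real[of C "max x (- real n)" "real n"]
          by (intro has_integral_add integrable_integral ui) auto
        then show ?thesis using True u0 nn_integral_has_integral_lebesgue'[of "{max x (- real n)..real
            n}" "\<lambda>y. u y + C"]
          by (simp add: mult.commute)
      qed simp
      finally show ?thesis .
    qed
    have "density lborel (?d g) = density lborel (?d k)"
    proof (rule measure_eqI_lessThan)
      fix x :: real
      show "emeasure (density lborel (?d g)) {x<..} < \<infinity>" using tail[of g] gB by simp
      show "emeasure (density lborel (?d g)) {x<..} = emeasure (density lborel (?d k)) {x<..}"
        using tail[of g] tail[of k] gB kB eq by simp
    qed auto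
    then have "AE x in lborel. ?d g x = ?d k x"
      by (subst (asm) sigma_finite_measure.density_unique_iff[OF sigma_finite_lborel]) auto
    then show ?thesis
      by eventually_elim (use g0 k0 in \<open>auto simp: indicator_def\<close>)
  qed
  then have "AE x in lborel. \<forall>n::nat. x \<in> {- real n..real n} \<longrightarrow> g x = k x"
    unfolding AE_all_countable by blast
  then show ?thesis
  proof eventually_elim
    case (elim x)
    obtain n :: nat where "\<bar>x\<bar> \<le> real n" using real_arch_simple by blast
    then show ?case using elim by (auto simp: abs_le_iff dest!: spec[of _ n])
  qed
qed

text \<open>
  The left derivative of \<open>F\<close> is the right derivative of the reflected function
  \<open>\<lambda>x. - F (- x)\<close>. The two one-sided derivatives have the same integrals over
  intervals, because both integrate to the increments of \<open>F\<close>, so they agree almost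
  everywhere.
\<close>

theorem lipschitz_has_derivative_AE:
  fixes F :: "real \<Rightarrow> real"
  assumes lip: "C-lipschitz_on UNIV F"
  shows "\<exists>g. g \<in> borel_measurable borel \<and> (\<forall>x. \<bar>g x\<bar> \<le> C) \<and>
    (\<forall>a b. a \<le> b \<longrightarrow> integral {a..b} g = F b - F a) \<and>
    (AE x in lborel. (F has_real_derivative g x) (at x))"
proof -
  have lip': "C-lipschitz_on UNIV (\<lambda>x. - F (- x))"
  proof (intro lipschitz_on_minus lipschitz_onI lipschitz_on_nonneg[OF lip])
    show "dist (F (- x)) (F (- y)) \<le> C * dist x y" for x y
      using lipschitz_onD[OF lip, of "- x" "- y"] by (simp add: dist_minus)
  qed
  obtain g where g: "g \<in> borel_measurable borel" "\<And>x. \<bar>g x\<bar> \<le> C"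
    "\<And>a b. a \<le> b \<Longrightarrow> integral {a..b} g = F b - F a"
    "AE x in lborel. ((\<lambda>h. (F (x + h) - F x) / h) \<longlongrightarrow> g x) (at_right 0)"
    using lipschitz_right_derivative[OF lip] by blast
  obtain k where k: "k \<in> borel_measurable borel" "\<And>x. \<bar>k x\<bar> \<le> C"
    "\<And>a b. a \<le> b \<Longrightarrow> integral {a..b} k = - F (- b) - - F (- a)"
    "AE x in lborel. ((\<lambda>h. (- F (- (x + h)) - - F (- x)) / h) \<longlongrightarrow> k x) (at_right 0)"
    using lipschitz_right_derivative[OF lip'] by blast
  have "AE x in lborel. g x = k (- x)"
  proof (rule AE_eq_if_interval_integrals_eq)
    fix a b :: real assume ab: "a \<le> b"
    have "integral {a..b} (\<lambda>x. k (- x)) = integral {- b..- a} k"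
      using Henstock_Kurzweil_Integration.integral_reflect_real[of "-a" "-b" k] by simp
    then show "integral {a..b} g = integral {a..b} (\<lambda>x. k (- x))" using g(3) k(3) ab by simp
  qed (use g k in \<open>auto intro: measurable_compose[OF borel_measurable_uminus]\<close>)
  moreover have "AE x in lborel. ((\<lambda>h. (- F (- (- x
      + h)) - - F (- (- x))) / h) \<longlongrightarrow> k (- x)) (at_right 0)"
    using AE_lborel_affine[OF _ k(4), of "-1" 0] by simp
  ultimately have "AE x in lborel. (F has_real_derivative g x) (at x)"
    using g(4)
  proof eventually_elim
    case (elim x)
    have "((\<lambda>h. (F (x + h) - F x) / h) \<longlongrightarrow> g x) (at_left 0)"
      unfolding filterlim_at_left_to_right minus_zero elim(1)
      using elim(2) by (rule Lim_transform_eventually)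
        (auto simp: elim(1) divide_simps intro!: eventually_at_rightI[of 0 1])
    then show ?case using elim(3) unfolding DERIV_def filterlim_at_split by simp
  qed
  then show ?thesis using g by blast
qed

section \<open>Calculus with derivatives that exist almost everywhere\<close>

lemma AE_lebesgue_negligibleE:
  fixes P :: "'a::euclidean_space \<Rightarrow> bool"
  assumes "AE x in lebesgue. P x"
  obtains N where "negligible N" "\<And>x. x \<notin> N \<Longrightarrow> P x"
proof -
  obtain N where N: "N \<in> null_sets lebesgue" "{x \<in> space lebesgue. \<not> P x} \<subseteq> N"
    using assms unfolding eventually_ae_filter by blast
  then have "negligible N" "\<And>x. x \<notin> N \<Longrightarrow> P x"
      by (auto simp: negligible_iff_null_sets)
  then show thesis by (rule that)
qed

lemma set_integral_spike_AE:
  fixes f g :: "'a::euclidean_space \<Rightarrow> 'b::euclidean_space"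
  assumes f: "set_integrable lebesgue S f" and ae: "AE x in lebesgue. x \<in> S \<longrightarrow> g x = f x"
  shows "set_integrable lebesgue S g" "(LINT x:S|lebesgue. g x) = (LINT x:S|lebesgue. f x)"
proof -
  obtain N where N: "negligible N" "\<And>x. x \<notin> N \<Longrightarrow>
      x \<in> S \<longrightarrow> g x = f x"
    using AE_lebesgue_negligibleE[OF ae] by blast
  show g: "set_integrable lebesgue S g"
    using absolutely_integrable_spike[OF f N(1), of g] N(2) by auto
  have "integral S g = integral S f"
    using N(2) by (intro integral_spike[OF N(1)]) auto
  then show "(LINT x:S|lebesgue. g x) = (LINT x:S|lebesgue. f x)"
    by (simp add: set_lebesgue_integral_eq_integral(2)[OF g] set_lebesgue_integral_eq_integral(2)[OF f])
qed

lemma set_integrable_lebesgue_of_lborel: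
  fixes f :: "real \<Rightarrow> real"
  assumes "set_integrable lborel S f"
  shows "set_integrable lebesgue S f" "(LINT x:S|lebesgue. f x) = (LINT x:S|lborel. f x)"
  using assms unfolding set_integrable_def set_lebesgue_integral_def
  by (auto simp: integrable_completion integral_completion dest: borel_measurable_integrable)

text \<open>
  Extending \<open>F\<close> by its boundary values keeps the Lipschitz constant and reduces the
  claim to functions on the whole line.
\<close>

theorem lipschitz_fundamental_theorem:
  fixes F g :: "real \<Rightarrow> real"
  assumes ab: "a \<le> b" and lip: "C-lipschitz_on {a..b} F"
    and der: "AE x in lebesgue. a < x \<and> x < b \<longrightarrow> (F has_real_derivative g x) (at x)"
  shows "set_integrable lebesgue {a..b} g" "(LINT x:{a..b}|lebesgue. g x) = F b - F a"
proof -
  let ?c = "\<lambda>x. max a (min b x)"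
  have "C-lipschitz_on UNIV (\<lambda>x. F (?c x))"
  proof (rule lipschitz_onI[OF _ lipschitz_on_nonneg[OF lip]])
    fix x y :: real
    have "dist (F (?c x)) (F (?c y)) \<le> C * dist (?c x) (?c y)"
      using ab by (intro lipschitz_onD[OF lip]) auto
    also have "\<dots> \<le> C * dist x y"
      by (intro mult_left_mono lipschitz_on_nonneg[OF lip]) (auto simp: dist_real_def)
    finally show "dist (F (?c x)) (F (?c y)) \<le> C * dist x y" .
  qed
  from lipschitz_has_derivative_AE[OF this]
  obtain k where k: "k \<in> borel_measurable borel" "\<And>x. \<bar>k x\<bar> \<le> C"
    "\<And>a' b'. a' \<le> b' \<Longrightarrow> integral {a'..b'} k = F (?c b') - F (?c a')"
    "AE x in lborel. ((\<lambda>x. F (?c x)) has_real_derivative k x) (at x)"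
    by blast
  have ki: "set_integrable lborel {a..b} k" by (rule bounded_borel_set_integrable[OF k(1,2)])
  have "AE x in lebesgue. x \<noteq> a" "AE x in lebesgue. x \<noteq> b"
    by (auto intro!: AE_completion AE_lborel_singleton)
  with der AE_completion[OF k(4)] have eq: "AE x in lebesgue. x \<in> {a..b} \<longrightarrow> g x = k x"
  proof eventually_elim
    case (elim x)
    show ?case
    proof
      assume x: "x \<in> {a..b}"
      have "a < x" "x < b" using x elim(3,4) by (simp_all add: less_le)
      then have "(F has_real_derivative g x) (at x)" using elim(1) by blast
      moreover have "(F has_real_derivative k x) (at x)"
        using \<open>a < x\<close> \<open>x < b\<close>
            by (intro has_field_derivative_transform_within_open[OF elim(2), of "{a<..<b}"]) auto
      ultimately show "g x = k x" by (rule DERIV_unique)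
    qed
  qed
  note * = set_integral_spike_AE[OF set_integrable_lebesgue_of_lborel(1)[OF ki] eq]
  show "set_integrable lebesgue {a..b} g" by (rule *)
  show "(LINT x:{a..b}|lebesgue. g x) = F b - F a"
    unfolding *(2) set_integrable_lebesgue_of_lborel(2)[OF ki] set_borel_integral_eq_integral(2)[OF ki]
    using k(3)[OF ab] ab by (simp add: max_def min_def)
qed

lemma countable_if_isolated:
  fixes S :: "'a::{metric_space,second_countable_topology} set"
  assumes "\<And>x. x \<in> S \<Longrightarrow> \<exists>e>0. \<forall>y\<in>S. y \<noteq> x
      \<longrightarrow> e \<le> dist x y"
  shows "countable S"
proof -
  obtain e where e: "\<And>x. x \<in> S \<Longrightarrow>
      0 < e x" "\<And>x y. \<lbrakk>x \<in> S; y \<in> S; y \<noteq> x\<rbrakk> \<Longrightarrow>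
          e x \<le> dist x y"
    using assms by metis
  obtain \<F> where F: "\<F> \<subseteq> (\<lambda>x. ball x (e x)) ` S" "countable \<F>" "\<Union>\<F>
      = \<Union>((\<lambda>x. ball x (e x)) ` S)"
    using Lindelof[of "(\<lambda>x. ball x (e x)) ` S"] by blast
  then obtain T where T: "countable T" "T \<subseteq> S" "\<F> = (\<lambda>x. ball x (e x)) ` T"
    using countable_subset_image[of \<F>] by metis
  have "S \<subseteq> T"
  proof
    fix y assume y: "y \<in> S"
    then have "y \<in> \<Union>\<F>" unfolding F(3) using e(1) by (auto intro!: bexI[of _ y])
    then obtain x where "x \<in> T" "dist x y < e x" using T(3) by auto
    then show "y \<in> T" using e(2)[of x y] y T(2) by force
  qed
  then show ?thesis using T(1) countable_subset by blast
qed

text \<open>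
  The outer function may fail to be differentiable at countably many values, and the inner function
  may take such a value on a set of positive measure. Where it does so with nonzero speed, the point
  is isolated in the level set, so only countably many such points exist. Where the speed is zero,
  the Lipschitz bound on \<open>G\<close> alone forces the derivative of the composition to vanish,
  whatever \<open>g\<close> says there.
\<close>

lemma chain_rule_off_countable:
  fixes G g r :: "real \<Rightarrow> real"
  assumes U: "open U" and lip: "K-lipschitz_on U G" and N: "countable N"
    and der: "\<And>y. \<lbrakk>y \<in> U; y \<notin> N\<rbrakk> \<Longrightarrow>
        (G has_real_derivative g y) (at y)"
  shows "\<exists>E. countable E \<and> (\<forall>x d. x \<notin> E \<longrightarrow>
      r x \<in> U \<longrightarrow> (r has_real_derivative d) (at x) \<longrightarrow>
    ((\<lambda>x. G (r x)) has_real_derivative g (r x) * d) (at x))"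
proof -
  define E where "E = (\<Union>y\<in>N. {x. r x
      = y \<and> (\<exists>d. d \<noteq> 0 \<and> (r has_real_derivative d) (at x))})"
  have "countable {x. r x = y \<and> (\<exists>d. d \<noteq> 0 \<and> (r has_real_derivative d) (at x))}"
      for y
  proof (rule countable_if_isolated)
    fix x assume "x \<in> {x. r x = y \<and> (\<exists>d. d \<noteq> 0 \<and> (r has_real_derivative d)
        (at x))}"
    then obtain d where d: "r x = y" "d \<noteq> 0" "(r has_real_derivative d) (at x)" by auto
    then have "\<forall>\<^sub>F z in at x. (r z - r x) / (z - x) \<noteq> 0"
      unfolding has_field_derivative_iff by (intro tendsto_imp_eventually_ne)
    then obtain e where "e > 0" "\<And>z. \<lbrakk>z \<noteq> x; dist z x < e\<rbrakk> \<Longrightarrow>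
        (r z - r x) / (z - x) \<noteq> 0"
      unfolding eventually_at by auto
    then show "\<exists>e>0. \<forall>z\<in>{x. r x
        = y \<and> (\<exists>d. d \<noteq> 0 \<and> (r has_real_derivative d) (at x))}. z \<noteq> x
            \<longrightarrow> e \<le> dist x z"
      using d(1) by (intro exI[of _ e]) (force simp: dist_commute not_le[symmetric])
  qed
  then have "countable E" unfolding E_def using N by (intro countable_UN) auto
  moreover have "((\<lambda>x. G (r x)) has_real_derivative g (r x) * d) (at x)"
    if x: "x \<notin> E" "r x \<in> U" and d: "(r has_real_derivative d) (at x)" for x d
  proof (cases "r x \<in> N")
    case False
    then show ?thesis using DERIV_chain2[OF der d] x by simp
  next
    case True
    then have d0: "d = 0" using x d by (auto simp: E_def)
    have "((\<lambda>z. (G (r z) - G (r x)) / (z - x)) \<longlongrightarrow> 0) (at x)"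
    proof (rule Lim_null_comparison)
      have "((\<lambda>z. r z) \<longlongrightarrow> r x) (at x)"
        using DERIV_isCont[OF d] by (simp add: isCont_def)
      then have "\<forall>\<^sub>F z in at x. r z \<in> U" using U x(2) by (rule topological_tendstoD)
      then show "\<forall>\<^sub>F z in at x. norm ((G (r z) - G (r x)) / (z - x))
          \<le> K * \<bar>(r z - r x) / (z - x)\<bar>"
      proof eventually_elim
        case (elim z)
        then have "\<bar>G (r z) - G (r x)\<bar> \<le> K * \<bar>r z - r x\<bar>"
          using lipschitz_onD[OF lip, of "r z" "r x"] x(2) by (simp add: dist_real_def)
        then show ?case by (auto simp: abs_divide divide_simps)
      qed
      have "((\<lambda>z. (r z - r x) / (z - x)) \<longlongrightarrow> 0) (at x)"
        using d d0 unfolding has_field_derivative_iff by simp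
      then show "((\<lambda>z. K * \<bar>(r z - r x) / (z - x)\<bar>) \<longlongrightarrow> 0) (at x)"
        by (intro tendsto_mult_right_zero tendsto_rabs_zero)
    qed
    then show ?thesis using d0 unfolding has_field_derivative_iff by simp
  qed
  ultimately show ?thesis by blast
qed

lemma derivative_le_lipschitz_constant:
  fixes F :: "real \<Rightarrow> real"
  assumes lip: "C-lipschitz_on UNIV F" and der: "(F has_real_derivative d) (at x)"
  shows "d \<le> C"
proof (rule tendsto_upperbound)
  show "((\<lambda>z. (F z - F x) / (z - x)) \<longlongrightarrow> d) (at x)"
      using der unfolding has_field_derivative_iff .
  have "(F z - F x) / (z - x) \<le> C" for z
    using lipschitz_onD[OF lip, of z x] lipschitz_on_nonneg[OF lip]
    by (cases "z = x") (auto simp: dist_real_def field_simps abs_if split: if_splits)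
  then show "\<forall>\<^sub>F z in at x. (F z - F x) / (z - x) \<le> C" by simp
qed simp

lemma inner_lipschitz:
  fixes f :: "real \<Rightarrow> 'a::real_inner"
  assumes "C-lipschitz_on S f"
  shows "(C * norm v)-lipschitz_on S (\<lambda>s. f s \<bullet> v)"
proof (rule lipschitz_onI)
  fix x y assume "x \<in> S" "y \<in> S"
  have "\<bar>f x \<bullet> v - f y \<bullet> v\<bar> \<le> norm (f x - f y) * norm v"
    by (metis Cauchy_Schwarz_ineq2 inner_diff_left)
  also have "\<dots> \<le> (C * dist x y) * norm v"
    using lipschitz_onD[OF assms \<open>x \<in> S\<close> \<open>y \<in> S\<close>]
        by (intro mult_right_mono) (auto simp: dist_norm)
  finally show "dist (f x \<bullet> v) (f y \<bullet> v) \<le> C * norm v * dist x y"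
      by (simp add: dist_real_def mult_ac)
qed (simp add: lipschitz_on_nonneg[OF assms])

lemma has_real_derivative_inner:
  assumes "(f has_vector_derivative t) (at x)"
  shows "((\<lambda>s. f s \<bullet> v) has_real_derivative t \<bullet> v) (at x)"
  using bounded_linear.has_vector_derivative[OF bounded_linear_inner_left assms]
  by (simp add: has_real_derivative_iff_has_vector_derivative)

lemma lipschitz_has_vector_derivative_AE:
  fixes f :: "real \<Rightarrow> 'a::euclidean_space"
  assumes lip: "C-lipschitz_on UNIV f"
  shows "\<exists>t. t \<in> borel_measurable borel \<and> (AE x in lborel. (f has_vector_derivative t x)
      (at x))"
proof -
  have "\<forall>i\<in>Basis. \<exists>g. g \<in> borel_measurable borel \<and>
     (AE x in lborel. ((\<lambda>s. f s \<bullet> i) has_real_derivative g x) (at x))"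
    using lipschitz_has_derivative_AE[OF inner_lipschitz[OF lip]] by blast
  then obtain g where g: "\<And>i. i \<in> Basis \<Longrightarrow> g i \<in> borel_measurable borel"
    "\<And>i. i \<in> Basis \<Longrightarrow> AE x in lborel. ((\<lambda>s. f s \<bullet> i)
        has_real_derivative g i x) (at x)"
    by metis
  define t where "t x = (\<Sum>i\<in>Basis. g i x *\<^sub>R i)" for x
  have "t \<in> borel_measurable borel" unfolding t_def using g(1)
      by (intro borel_measurable_sum borel_measurable_scaleR) auto
  moreover have "AE x in lborel. \<forall>i\<in>Basis. ((\<lambda>s. f s \<bullet> i) has_real_derivative
      g i x) (at x)"
    using g(2) by (intro AE_finite_allI) auto
  then have "AE x in lborel. (f has_vector_derivative t x) (at x)"
  proof eventually_elim
    case (elim x)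
    have "((\<lambda>s. f s \<bullet> i) has_derivative (\<lambda>h. (h *\<^sub>R t x) \<bullet> i)) (at
        x)" if i: "i \<in> Basis" for i
    proof -
      have "t x \<bullet> i = g i x" using i by (simp add: t_def)
      then show ?thesis using elim i
        by (simp add: has_real_derivative_iff_has_vector_derivative has_vector_derivative_def)
    qed
    then show ?case unfolding has_vector_derivative_def
      by (subst has_derivative_componentwise_within) auto
  qed
  ultimately show ?thesis by blast
qed

section \<open>Arc-length parametrizations have unit speed\<close>

lemma curve_length_le:
  assumes V: "\<And>x y. \<lbrakk>a \<le> x; x \<le> y; y \<le> b\<rbrakk> \<Longrightarrow>
      dist (f x) (f y) \<le> V y - V x" and ab: "a \<le> b"
  shows "curve_length f a b \<le> ennreal (V b - V a)"
  unfolding curve_length_def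
proof (rule SUP_least)
  fix ts assume "ts \<in> {ts. sorted ts \<and> set ts \<subseteq> {a..b}}"
  then have ts: "sorted ts" "set ts \<subseteq> {a..b}" by auto
  have V0: "V x \<le> V y" if "a \<le> x" "x \<le> y" "y \<le> b" for x y
    using V[OF that] zero_le_dist[of "f x" "f y"] by linarith
  let ?n = "length ts - 1"
  show "(\<Sum>i<?n. ennreal (dist (f (ts ! i)) (f (ts ! Suc i)))) \<le> ennreal (V b - V a)"
  proof (cases "ts = []")
    case True
    then show ?thesis by simp
  next
    case False
    have mem: "ts ! i \<in> {a..b}" if "i \<le> ?n" for i
      using ts(2) nth_mem[of i ts] that False by (cases ts) auto
    have "(\<Sum>i<?n. ennreal (dist (f (ts ! i)) (f (ts ! Suc i))))
        \<le> (\<Sum>i<?n. ennreal (V (ts ! Suc i) - V (ts ! i)))"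
    proof (intro sum_mono ennreal_leI V)
      fix i assume "i \<in> {..<?n}"
      then show "a \<le> ts ! i" "ts ! i \<le> ts ! Suc i" "ts ! Suc i \<le> b"
        using mem[of i] mem[of "Suc i"] sorted_nth_mono[OF ts(1), of i "Suc i"] by auto
    qed
    also have "\<dots> = ennreal (\<Sum>i<?n. V (ts ! Suc i) - V (ts ! i))"
    proof (rule sum_ennreal)
      fix i assume "i \<in> {..<?n}"
      then show "0 \<le> V (ts ! Suc i) - V (ts ! i)"
        using V0[of "ts ! i" "ts ! Suc i"] mem[of i] mem[of "Suc i"] sorted_nth_mono[OF ts(1), of i "Suc
            i"] by auto
    qed
    also have "\<dots> = ennreal (V (ts ! ?n) - V (ts ! 0))"
      by (simp add: sum_lessThan_telescope[of "\<lambda>i. V (ts ! i)"])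
    also have "\<dots> \<le> ennreal (V b - V a)"
      using mem[of 0] mem[of ?n] V0[of a "ts ! 0"] V0[of "ts ! ?n" b] by (intro ennreal_leI) auto
    finally show ?thesis .
  qed
qed

lemma dist_le_curve_length:
  assumes "a \<le> b"
  shows "ennreal (dist (f a) (f b)) \<le> curve_length f a b"
  unfolding curve_length_def using assms by (intro SUP_upper2[of "[a, b]"]) auto

lemma arclength_lipschitz:
  fixes f :: "real \<Rightarrow> 'a::metric_space"
  assumes "\<And>a b. a \<le> b \<Longrightarrow> curve_length f a b = ennreal (b - a)"
  shows "1-lipschitz_on UNIV f"
proof -
  have "dist (f a) (f b) \<le> b - a" if "a \<le> b" for a b
    using dist_le_curve_length[OF that, of f] assms[OF that] that by simp
  then show ?thesis by (intro lipschitz_on_leI) (auto simp: dist_real_def)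
qed

text \<open>
  With the unit vector along a chord as \<open>v\<close> this bounds the chord by the integral of
  the speed; with the tangent at a base point it produces the boundary terms.
\<close>

lemma unit_inner_increment:
  fixes f t :: "real \<Rightarrow> 'a::euclidean_space"
  assumes lip: "1-lipschitz_on UNIV f" and ab: "a \<le> b"
    and der: "AE s in lebesgue. (f has_vector_derivative t s) (at s)"
  shows "set_integrable lebesgue {a..b} (\<lambda>s. t s \<bullet> v)"
    and "(LINT s:{a..b}|lebesgue. t s \<bullet> v) = (f b - f a) \<bullet> v"
proof -
  have *: "(1 * norm v)-lipschitz_on {a..b} (\<lambda>s. f s \<bullet> v)"
    using inner_lipschitz[OF lip] by (rule lipschitz_on_subset) auto
  have **: "AE s in lebesgue. a < s \<and> s < b \<longrightarrow>
      ((\<lambda>s. f s \<bullet> v) has_real_derivative t s \<bullet> v) (at s)"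
    using der by eventually_elim (auto intro: has_real_derivative_inner)
  show "set_integrable lebesgue {a..b} (\<lambda>s. t s \<bullet> v)"
    by (rule lipschitz_fundamental_theorem(1)[OF ab * **])
  show "(LINT s:{a..b}|lebesgue. t s \<bullet> v) = (f b - f a) \<bullet> v"
    unfolding lipschitz_fundamental_theorem(2)[OF ab * **] by (simp add: inner_diff_left)
qed

text \<open>
  The speed is at most \<open>1\<close> because the curve is \<open>1\<close>-Lipschitz, and every
  arc is at most as long as the integral of the speed over it. As an arc over \<open>{a..b}\<close>
  has length \<open>b - a\<close>, the speed integrates to \<open>b - a\<close> over every interval,
  so it is \<open>1\<close> almost everywhere.
\<close>

theorem arclength_unit_tangent:
  fixes f :: "real \<Rightarrow> 'a::euclidean_space"
  assumes len: "\<And>a b. a \<le> b \<Longrightarrow> curve_length f a b = ennreal (b - a)"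
  shows "\<exists>t. t \<in> borel_measurable borel \<and> (\<forall>s. norm (t s) = 1) \<and>
    (AE s in lborel. (f has_vector_derivative t s) (at s))"
proof -
  note lip = arclength_lipschitz[OF len]
  obtain t where t[measurable]: "t \<in> borel_measurable borel"
    and der: "AE s in lborel. (f has_vector_derivative t s) (at s)"
    using lipschitz_has_vector_derivative_AE[OF lip] by blast
  have t1: "AE s in lborel. norm (t s) \<le> 1"
    using der
  proof eventually_elim
    case (elim s)
    have "t s \<bullet> t s \<le> norm (t s)"
      using derivative_le_lipschitz_constant[OF inner_lipschitz[OF lip, of "t s"]
          has_real_derivative_inner[OF elim]]
      by simp
    then have "norm (t s) * norm (t s) \<le> norm (t s) * 1" by (simp add: dot_square_norm power2_eq_square)
    then show ?case by (cases "norm (t s) = 0") (auto simp: mult_le_cancel_left)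
  qed
  define w where "w s = min 1 (norm (t s))" for s
  have [measurable]: "w \<in> borel_measurable borel" unfolding w_def by measurable
  have wt: "AE s in lborel. w s = norm (t s)" using t1 by eventually_elim (simp add: w_def)
  have wint: "set_integrable lborel {a..b} w" for a b
    by (rule bounded_borel_set_integrable[where B=1]) (auto simp: w_def)
  have w_on: "w integrable_on {a..b}" for a b using set_borel_integral_eq_integral(1)[OF wint] .
  have chord: "dist (f x) (f y) \<le> integral {x..y} w" if xy: "x \<le> y" for x y
  proof -
    define v where "v = sgn (f y - f x)"
    have v: "norm v \<le> 1" by (simp add: v_def norm_sgn)
    have "dist (f x) (f y) = (f y - f x) \<bullet> v"
      by (cases "f x = f y")
        (simp_all add: v_def sgn_div_norm dist_norm norm_minus_commute dot_square_norm power2_eq_square)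
    also have "\<dots> = (LINT s:{x..y}|lebesgue. t s \<bullet> v)"
      using unit_inner_increment(2)[OF lip xy AE_completion[OF der]] by simp
    also have "\<dots> \<le> (LINT s:{x..y}|lebesgue. w s)"
    proof (rule set_integral_mono_AE)
      show "set_integrable lebesgue {x..y} (\<lambda>s. t s \<bullet> v)"
        by (rule unit_inner_increment(1)[OF lip xy AE_completion[OF der]])
      show "set_integrable lebesgue {x..y} w" by (rule set_integrable_lebesgue_of_lborel(1)[OF wint])
      show "AE s\<in>{x..y} in lebesgue. t s \<bullet> v \<le> w s"
        using AE_completion[OF wt]
      proof eventually_elim
        case (elim s)
        have "t s \<bullet> v \<le> norm (t s) * norm v" by (rule norm_cauchy_schwarz)
        also have "\<dots> \<le> norm (t s)" using v by (simp add: mult_left_le)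
        finally show ?case using elim by simp
      qed
    qed
    also have "\<dots> = integral {x..y} w"
      by (simp add: set_lebesgue_integral_eq_integral(2) set_integrable_lebesgue_of_lborel(1)[OF wint])
    finally show ?thesis .
  qed
  have full: "integral {a..b} w = b - a" if ab: "a \<le> b" for a b
  proof (rule antisym)
    have "integral {a..b} w \<le> integral {a..b} (\<lambda>_. 1)"
        by (intro integral_le w_on) (auto simp: w_def)
    then show "integral {a..b} w \<le> b - a" using ab by simp
    have "ennreal (b - a) \<le> ennreal (integral {a..b} w - integral {a..a} w)"
      unfolding len[OF ab, symmetric]
    proof (rule curve_length_le[OF _ ab])
      fix x y assume "a \<le> x" "x \<le> y" "y \<le> b"
      then show "dist (f x) (f y) \<le> integral {a..y} w - integral {a..x} w"
        using Henstock_Kurzweil_Integration.integral_combine[of a x y w] w_on chord[of x y] by simp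
    qed
    moreover have "0 \<le> integral {a..b} w" by (intro integral_nonneg w_on) (auto simp: w_def)
    ultimately show "b - a \<le> integral {a..b} w" using ab by simp
  qed
  have "AE s in lborel. w s = 1"
    by (rule AE_eq_if_interval_integrals_eq[where C=1]) (auto simp: w_def full[unfolded w_def])
  then have t1': "AE s in lborel. norm (t s) = 1" using wt by eventually_elim simp
  obtain e :: 'a where e: "norm e = 1" using SOME_Basis norm_Basis by blast
  \<comment> \<open>A unit vector also on the exceptional null set spares measure-zero side conditions
      later.\<close>
  define t' where "t' s = (if norm (t s) = 1 then t s else e)" for s
  have "AE s in lborel. (f has_vector_derivative t' s) (at s)"
    using der t1' by eventually_elim (simp add: t'_def)
  moreover have "t' \<in> borel_measurable borel" unfolding t'_def by measurable
  moreover have "norm (t' s) = 1" for s using e by (simp add: t'_def)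
  ultimately show ?thesis by blast
qed

section \<open>The kernel and its tail integral\<close>

definition tail :: "(real \<Rightarrow> real) \<Rightarrow> real \<Rightarrow> real" where
  "tail \<Phi> x = (LINT t:{x..}|lebesgue. 1 / \<Phi> t)"

lemma Lambda_eq_tail: "Lambda \<Phi> x = - tail \<Phi> x / x"
  by (simp add: Lambda_def tail_def)

locale energy_kernel =
  fixes \<Phi> :: "real \<Rightarrow> real"
  assumes Phi_pos: "\<And>x. x > 0 \<Longrightarrow> \<Phi> x > 0"
    and Phi_mono: "mono_on {0<..} \<Phi>"
    and Phi_integrable: "\<And>x. x > 0 \<Longrightarrow>
        set_integrable lebesgue {x..} (\<lambda>t. 1 / \<Phi> t)"
begin

lemma inverse_Phi_antimono: "\<lbrakk>0 < x; x \<le> y\<rbrakk> \<Longrightarrow>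
    1 / \<Phi> y \<le> 1 / \<Phi> x"
  using Phi_pos[of x] mono_onD[OF Phi_mono, of x y]
      by (intro divide_left_mono) (auto intro: mult_pos_pos Phi_pos)

text \<open>
  The hypotheses control \<open>\<Phi>\<close> on positive arguments only; the value
  \<open>0\<close> elsewhere makes this function Borel measurable on the whole line.
\<close>

definition recip :: "real \<Rightarrow> real" where
  "recip x = (if 0 < x then 1 / \<Phi> x else 0)"

lemma recip_nonneg: "0 \<le> recip x"
  using Phi_pos[of x] by (auto simp: recip_def less_imp_le)

lemma recip_antimono: "\<lbrakk>0 < x; x \<le> y\<rbrakk> \<Longrightarrow> recip y \<le> recip x"
  using inverse_Phi_antimono[of x y] by (simp add: recip_def)

lemma recip_measurable[measurable]: "recip \<in> borel_measurable borel"
proof -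
  have "(\<lambda>x. - recip x) \<in> borel_measurable borel"
    by (rule borel_measurable_piecewise_mono[where C="{{..0}, {0<..}}"])
      (auto simp: mono_on_def recip_def intro: inverse_Phi_antimono)
  then show ?thesis by simp
qed

lemma tail_diff_bounds:
  assumes x: "0 < x" and xy: "x \<le> y"
  shows "tail \<Phi> x - tail \<Phi> y = (LINT t:{x..y}|lebesgue. 1 / \<Phi> t)"
    and "(y - x) / \<Phi> y \<le> tail \<Phi> x - tail \<Phi> y" and "tail \<Phi> x - tail \<Phi> y
        \<le> (y - x) / \<Phi> x"
proof -
  have sub: "set_integrable lebesgue S (\<lambda>t. 1 / \<Phi> t)"
      if "S \<in> sets lebesgue" "S \<subseteq> {x..}" for S
    using set_integrable_subset[OF Phi_integrable[OF x]] that by blast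
  have ray: "{y<..} \<subseteq> {x..}" "{y..} \<subseteq> {x..}" using xy by auto
  have "tail \<Phi> x = (LINT t:{x..y} \<union> {y<..}|lebesgue. 1 / \<Phi> t)"
    unfolding tail_def using xy by (intro arg_cong2[where f="set_lebesgue_integral lebesgue"]) auto
  also have "\<dots> = (LINT t:{x..y}|lebesgue. 1 / \<Phi> t) + (LINT t:{y<..}|lebesgue. 1 / \<Phi> t)"
    using xy by (intro set_integral_Un sub) auto
  also have "(LINT t:{y<..}|lebesgue. 1 / \<Phi> t) = tail \<Phi> y"
    unfolding tail_def set_lebesgue_integral_def
    by (intro integral_cong_AE)
      (use sub[OF _ ray(1)] sub[OF _ ray(2)] AE_completion[OF AE_lborel_singleton[of y]] in
        \<open>auto simp: set_integrable_def dest!: borel_measurable_integrable elim!: eventually_mono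
            split: split_indicator\<close>)
  finally show eq: "tail \<Phi> x - tail \<Phi> y = (LINT t:{x..y}|lebesgue. 1 / \<Phi> t)" by simp
  have const: "set_integrable lebesgue {x..y} (\<lambda>_. c)" "(LINT t:{x..y}|lebesgue. c)
      = (y - x) * c" for c :: real
    using xy by (auto simp: set_integrable_def set_lebesgue_integral_def)
  have "(LINT t:{x..y}|lebesgue. 1 / \<Phi> y) \<le> (LINT t:{x..y}|lebesgue. 1 / \<Phi> t)"
    using x by (intro set_integral_mono const sub inverse_Phi_antimono) auto
  then show "(y - x) / \<Phi> y \<le> tail \<Phi> x - tail \<Phi> y" by (simp add: eq const)
  have "(LINT t:{x..y}|lebesgue. 1 / \<Phi> t) \<le> (LINT t:{x..y}|lebesgue. 1 / \<Phi> x)"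
    using x by (intro set_integral_mono const sub inverse_Phi_antimono) auto
  then show "tail \<Phi> x - tail \<Phi> y \<le> (y - x) / \<Phi> x" by (simp add: eq const)
qed

lemma tail_nonneg: "0 < x \<Longrightarrow> 0 \<le> tail \<Phi> x"
  unfolding tail_def set_lebesgue_integral_def
  using Phi_pos by (intro Bochner_Integration.integral_nonneg) (auto simp: indicator_def less_imp_le)

lemma tail_antimono: "\<lbrakk>0 < x; x \<le> y\<rbrakk> \<Longrightarrow> tail \<Phi> y \<le> tail \<Phi> x"
proof -
  assume x: "0 < x" "x \<le> y"
  then have "0 \<le> (y - x) / \<Phi> y" using Phi_pos[of y] by (intro divide_nonneg_pos) auto
  then show "tail \<Phi> y \<le> tail \<Phi> x" using tail_diff_bounds(2)[OF x] by simp
qed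

lemma tail_lipschitz:
  assumes c: "0 < c"
  shows "(1 / \<Phi> c)-lipschitz_on {c..} (tail \<Phi>)"
proof (rule lipschitz_on_leI)
  fix x y assume "x \<in> {c..}" "y \<in> {c..}" "x \<le> y"
  then have x: "0 < x" "x \<le> y" "c \<le> x" using c by auto
  have "dist (tail \<Phi> x) (tail \<Phi> y) \<le> (y - x) * (1 / \<Phi> x)"
    using tail_antimono[OF x(1,2)] tail_diff_bounds(3)[OF x(1,2)] by (simp add: dist_real_def)
  also have "\<dots> \<le> (y - x) * (1 / \<Phi> c)" using x inverse_Phi_antimono[OF c x(3)]
      by (intro mult_left_mono) auto
  finally show "dist (tail \<Phi> x) (tail \<Phi> y) \<le> 1 / \<Phi> c * dist x y" using x
      by (simp add: dist_real_def mult.commute)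
qed (use Phi_pos[OF c] in simp)

text \<open>
  Monotonicity of \<open>\<Phi>\<close> squeezes every difference quotient between the values of
  \<open>- 1 / \<Phi>\<close> at the two end points. Together with the countability of the jumps of
  \<open>\<Phi>\<close> this feeds the chain rule above.
\<close>

lemma tail_has_derivative:
  assumes x: "0 < x" and cont: "isCont \<Phi> x"
  shows "(tail \<Phi> has_real_derivative - recip x) (at x)"
proof -
  have inv: "((\<lambda>y. 1 / \<Phi> y) \<longlongrightarrow> 1 / \<Phi> x) (at x)"
    using cont Phi_pos[OF x] by (intro tendsto_intros) (auto simp: isCont_def)
  have near: "\<forall>\<^sub>F y in at x. 0 < y"
    using x by (auto simp: eventually_at dist_real_def intro!: exI[of _ x])
  have "((\<lambda>y. - (tail \<Phi> y - tail \<Phi> x) / (y - x)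
      - 1 / \<Phi> x) \<longlongrightarrow> 0) (at x)"
  proof (rule Lim_null_comparison)
    show "\<forall>\<^sub>F y in at x. norm (- (tail \<Phi> y - tail \<Phi> x) / (y - x)
        - 1 / \<Phi> x) \<le> \<bar>1 / \<Phi> y - 1 / \<Phi> x\<bar>"
      using near eventually_neq_at_within[of x x UNIV]
    proof eventually_elim
      case (elim y)
      let ?q = "- (tail \<Phi> y - tail \<Phi> x) / (y - x)"
      show ?case
      proof (cases "x < y")
        case True
        have "1 / \<Phi> y \<le> ?q" "?q \<le> 1 / \<Phi> x"
          using tail_diff_bounds(2,3)[OF x, of y] True by (auto simp: field_simps)
        then show ?thesis by (simp add: abs_if)
      next
        case False
        then have yx: "y < x" using elim by auto
        have "?q = (tail \<Phi> y - tail \<Phi> x) / (x - y)"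
          using minus_divide_divide[of "tail \<Phi> y - tail \<Phi> x" "x - y"] by simp
        moreover have "1 / \<Phi> x \<le> (tail \<Phi> y - tail \<Phi> x) / (x - y)" "(tail \<Phi> y
            - tail \<Phi> x) / (x - y) \<le> 1 / \<Phi> y"
          using tail_diff_bounds(2,3)[OF elim(1), of x] yx
          by (simp_all add: pos_le_divide_eq pos_divide_le_eq)
        ultimately have "1 / \<Phi> x \<le> ?q" "?q \<le> 1 / \<Phi> y" by simp_all
        then show ?thesis by (simp add: abs_if)
      qed
    qed
    show "((\<lambda>y. \<bar>1 / \<Phi> y - 1 / \<Phi> x\<bar>) \<longlongrightarrow> 0) (at x)"
      using tendsto_diff[OF inv tendsto_const[of "1 / \<Phi> x"]] by (intro tendsto_rabs_zero) simp
  qed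
  then have "((\<lambda>y. - (tail \<Phi> y - tail \<Phi> x) / (y
      - x)) \<longlongrightarrow> 1 / \<Phi> x) (at x)"
    by (rule LIM_zero_cancel)
  from tendsto_minus[OF this] have "((\<lambda>y. (tail \<Phi> y - tail \<Phi> x) / (y
      - x)) \<longlongrightarrow> - (1 / \<Phi> x)) (at x)"
    unfolding minus_divide_left minus_minus .
  then show ?thesis
    unfolding has_field_derivative_iff recip_def using x by simp
qed

lemma countable_discontinuities: "countable {x \<in> {0<..}. \<not> isCont \<Phi> x}"
  by (rule mono_on_ctble_discont_open[OF open_greaterThan Phi_mono])

end

section \<open>The density is a derivative up to the chord kernel\<close>

lemma lipschitz_on_mult_compact:
  fixes f g :: "real \<Rightarrow> real"
  assumes S: "compact S" and f: "C-lipschitz_on S f" and g: "D-lipschitz_on S g"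
  shows "\<exists>E. E-lipschitz_on S (\<lambda>x. f x * g x)"
proof -
  have "bounded (f ` S)" "bounded (g ` S)"
    using S f g by (auto intro!: compact_imp_bounded compact_continuous_image lipschitz_on_continuous_on)
  then obtain M N where M: "\<And>x. x \<in> S \<Longrightarrow>
      \<bar>f x\<bar> \<le> M" and N: "\<And>x. x \<in> S \<Longrightarrow> \<bar>g x\<bar> \<le> N"
    unfolding bounded_iff by auto
  have "\<bar>f x * g x - f y * g y\<bar>
      \<le> (\<bar>M\<bar> * D + \<bar>N\<bar> * C) * \<bar>x - y\<bar>" if "x \<in> S" "y \<in> S" for x y
  proof -
    have "\<bar>f x * g x - f y * g y\<bar> = \<bar>f x * (g x - g y) + g y * (f x - f y)\<bar>"
        by (simp add: algebra_simps)
    also have "\<dots> \<le> \<bar>f x\<bar> * \<bar>g x - g y\<bar>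
        + \<bar>g y\<bar> * \<bar>f x - f y\<bar>"
      using abs_triangle_ineq[of "f x * (g x - g y)" "g y * (f x - f y)"] by (simp add: abs_mult)
    also have "\<dots> \<le> \<bar>M\<bar> * (D * \<bar>x - y\<bar>)
        + \<bar>N\<bar> * (C * \<bar>x - y\<bar>)"
    proof (intro add_mono mult_mono abs_ge_zero)
      show "\<bar>f x\<bar> \<le> \<bar>M\<bar>" using M[OF that(1)] by simp
      show "\<bar>g y\<bar> \<le> \<bar>N\<bar>" using N[OF that(2)] by simp
      show "\<bar>g x - g y\<bar> \<le> D * \<bar>x - y\<bar>" using lipschitz_onD[OF g that]
          by (simp add: dist_real_def)
      show "\<bar>f x - f y\<bar> \<le> C * \<bar>x - y\<bar>" using lipschitz_onD[OF f that]
          by (simp add: dist_real_def)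
    qed
    finally show ?thesis by (simp add: algebra_simps)
  qed
  then have "(\<bar>M\<bar> * D + \<bar>N\<bar> * C)-lipschitz_on S (\<lambda>x. f x * g x)"
    using lipschitz_on_nonneg[OF f] lipschitz_on_nonneg[OF g]
    by (intro lipschitz_onI) (auto simp: dist_real_def)
  then show ?thesis by blast
qed

lemma lipschitz_on_inverse:
  fixes r :: "real \<Rightarrow> real"
  assumes r: "C-lipschitz_on S r" and \<rho>: "0 < \<rho>" and lower: "\<And>x. x \<in> S
      \<Longrightarrow> \<rho> \<le> r x"
  shows "(C / \<rho>\<^sup>2)-lipschitz_on S (\<lambda>x. 1 / r x)"
proof (rule lipschitz_onI)
  fix x y assume xy: "x \<in> S" "y \<in> S"
  then have pos: "\<rho> \<le> r x" "\<rho> \<le> r y" "0 < r x" "0 < r y" using lower \<rho> by force+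
  have "\<bar>1 / r x - 1 / r y\<bar> = \<bar>r x - r y\<bar> / (r x * r y)"
    using pos by (simp add: divide_simps abs_mult abs_minus_commute)
  also have "\<dots> \<le> C * \<bar>x - y\<bar> / (\<rho> * \<rho>)"
    using lipschitz_onD[OF r xy] pos \<rho> by (intro frac_le mult_mono) (auto simp: dist_real_def)
  finally show "dist (1 / r x) (1 / r y) \<le> C / \<rho>\<^sup>2 * dist x y"
    by (simp add: dist_real_def power2_eq_square)
qed (use lipschitz_on_nonneg[OF r] in auto)

lemma norm_has_real_derivative:
  fixes v :: "real \<Rightarrow> 'a::real_inner"
  assumes v: "(v has_vector_derivative w) (at x)" and ne: "v x \<noteq> 0"
  shows "((\<lambda>x. norm (v x)) has_real_derivative (v x \<bullet> w) / norm (v x)) (at x)"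
proof -
  have d: "((\<lambda>x. v x \<bullet> v x) has_real_derivative 2 * (v x \<bullet> w)) (at x)"
    using v unfolding has_real_derivative_iff_has_vector_derivative has_vector_derivative_def
    by (auto intro!: derivative_eq_intros simp: inner_commute algebra_simps)
  have pos: "0 < v x \<bullet> v x" using ne by simp
  note D = DERIV_chain2[where f = sqrt and g = "\<lambda>x. v x \<bullet> v x" and x
      = x, OF DERIV_real_sqrt[OF pos] d]
  have "inverse S / 2 * (2 * A) = A / S" for S A :: real by (simp add: inverse_eq_divide)
  then show ?thesis unfolding norm_eq_sqrt_inner by (rule DERIV_cong[OF D])
qed

text \<open>
  The pointwise identity behind \<open>density_integral\<close>: \<open>R\<close> is the chord
  length, \<open>k\<close> and \<open>G\<close> are the kernel and its tail there, \<open>p\<close>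
  and \<open>q\<close> are the inner products of the chord with the two tangents, and
  \<open>d\<close> is that of the tangents.
\<close>

lemma density_algebra:
  fixes R :: real
  assumes "R > 0"
  shows "(1 - d) * k + (k + G / R) * (d - p * q / R\<^sup>2) - k
    = - ((- k * (- q / R) * (1 / R) + q / R ^ 3 * G) * p + - d * (G * (1 / R)))"
  using assms by (simp add: field_simps power2_eq_square power3_eq_cube)

lemma circle_dist_shift:
  assumes L: "L > 0" and h: "\<bar>h\<bar> \<le> L / 2"
  shows "circle_dist L s (s + h) = \<bar>h\<bar>"
proof -
  have low: "\<bar>h\<bar> \<le> \<bar>s - (s + h) + of_int k * L\<bar>" for k :: int
  proof (cases "k = 0")
    case False
    then have "1 \<le> \<bar>real_of_int k\<bar>" by linarith
    then have "L \<le> \<bar>of_int k * L\<bar>" using L by (simp add: abs_mult)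
    then show ?thesis using h by linarith
  qed simp
  have "bdd_below (range (\<lambda>k::int. \<bar>s - (s + h) + of_int k * L\<bar>))"
    using low by (intro bdd_belowI2) auto
  then have "circle_dist L s (s + h) \<le> \<bar>s - (s + h) + of_int 0 * L\<bar>"
    unfolding circle_dist_def by (rule cINF_lower) auto
  moreover have "\<bar>h\<bar> \<le> circle_dist L s (s + h)"
    unfolding circle_dist_def using low by (intro cINF_greatest) auto
  ultimately show ?thesis by simp
qed

lemma circle_dist_periodic: "circle_dist L s (t + L) = circle_dist L s t"
proof -
  have "range (\<lambda>k::int. \<bar>s - (t + L) + of_int k * L\<bar>)
      = range (\<lambda>k::int. \<bar>s - t + of_int k * L\<bar>)" (is "?A = ?B")
  proof
    have "\<bar>s - (t + L) + of_int k * L\<bar> = \<bar>s - t + of_int (k - 1) * L\<bar>" for k :: int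
      by (simp add: algebra_simps)
    then show "?A \<subseteq> ?B" by blast
    have "\<bar>s - t + of_int k * L\<bar> = \<bar>s - (t + L) + of_int (k + 1) * L\<bar>" for k :: int
      by (simp add: algebra_simps)
    then show "?B \<subseteq> ?A" by blast
  qed
  then show ?thesis unfolding circle_dist_def by simp
qed

lemma circle_dist_measurable: "(\<lambda>x. circle_dist L (fst x) (snd x)) \<in> borel_measurable borel"
  unfolding circle_dist_def
  by (intro borel_measurable_cINF) (auto intro!: bdd_belowI2[where m=0] borel_measurable_continuous_onI
      continuous_intros)

text \<open>
  In the offset \<open>h\<close> from a base point, \<open>\<bar>h\<bar>\<close> is the distance
  along the curve as long as it is at most half a period. The field \<open>\<tau>\<close> is a Borel
  representative of the tangent.
\<close>

locale bilipschitz_arclength_curve = energy_kernel \<Phi> for \<Phi> +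
  fixes L c :: real and f \<tau> :: "real \<Rightarrow> real ^ 'n"
  assumes L_pos: "L > 0" and c_pos: "c > 0"
    and f_periodic: "\<And>s. f (s + L) = f s"
    and f_lipschitz: "1-lipschitz_on UNIV f"
    and chord_lower: "\<And>s h. \<bar>h\<bar> \<le> L / 2 \<Longrightarrow>
        c * \<bar>h\<bar> \<le> norm (f s - f (s + h))"
    and \<tau>_measurable[measurable]: "\<tau> \<in> borel_measurable borel"
    and \<tau>_unit: "\<And>s. norm (\<tau> s) = 1"
    and \<tau>_derivative: "AE s in lborel. (f has_vector_derivative \<tau> s) (at s)"
begin

lemma f_continuous: "continuous_on S f"
  using lipschitz_on_continuous_on[OF f_lipschitz] continuous_on_subset by blast

lemma f_measurable[measurable]: "f \<in> borel_measurable borel"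
  by (rule borel_measurable_continuous_onI[OF f_continuous])

lemma chord_upper: "norm (f s - f (s + h)) \<le> \<bar>h\<bar>"
  using lipschitz_onD[OF f_lipschitz, of s "s + h"] by (simp add: dist_norm)

lemma chord_pos: "\<lbrakk>h \<noteq> 0; \<bar>h\<bar> \<le> L / 2\<rbrakk> \<Longrightarrow>
    0 < norm (f s - f (s + h))"
  using chord_lower[of h s] c_pos mult_pos_pos[of c "\<bar>h\<bar>"] by linarith

lemma tangent_eq: "AE s in lebesgue. tangent f s = \<tau> s"
  using AE_completion[OF \<tau>_derivative] by eventually_elim (simp add: tangent_def vector_derivative_at)

text \<open>
  The primitive that appears at the ends of the truncated integrals, as a function of the offset.
\<close>

definition boundary :: "real \<Rightarrow> real \<Rightarrow> real" where
  "boundary s h = Lambda \<Phi> (norm (f s - f (s + h))) * ((f s - f (s + h)) \<bullet> \<tau> s)"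

lemma chord_has_derivative:
  assumes f: "(f has_vector_derivative t) (at x)" and ne: "f s \<noteq> f x"
  shows "((\<lambda>x. norm (f s - f x)) has_real_derivative - ((f s - f x) \<bullet> t) / norm (f s
      - f x)) (at x)"
  using norm_has_real_derivative[OF has_vector_derivative_diff[OF has_vector_derivative_const[of "f s"] f]] ne
  by (simp add: inner_minus_right)

text \<open>
  For a fixed base point \<open>s\<close> put \<open>r x = norm (f s - f x)\<close>. As
  \<open>\<Lambda>' = (1 / \<Phi> - \<Lambda>) / r\<close> and the derivative of \<open>r\<close> at
  \<open>x\<close> is minus the component of \<open>\<tau> x\<close> along the chord, the product
  rule shows that \<open>M1 + M2\<close> equals \<open>1 / \<Phi> (r x)\<close> plus the derivative
  of \<open>\<Lambda> (r x) * ((f s - f x) \<bullet> \<tau> s)\<close> for almost every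
  \<open>x\<close>. Keeping the offset \<open>0\<close> out of the interval bounds \<open>r\<close>
  from below, and \<open>\<Lambda>\<close> is Lipschitz on \<open>{\<rho>..}\<close> for every
  \<open>\<rho> > 0\<close>.
\<close>

theorem density_integral:
  assumes s: "tangent f s = \<tau> s" and ab: "a \<le> b" and range: "- (L / 2) \<le> a" "b
      \<le> L / 2" and zero: "0 \<notin> {a..b}"
  shows "set_integrable lebesgue {s + a..s + b} (\<lambda>x. M1 \<Phi> f s x + M2 \<Phi> f s x)" (is ?int)
    and "(LINT x:{s + a..s + b}|lebesgue. M1 \<Phi> f s x + M2 \<Phi> f s x) =
      (LINT x:{s + a..s + b}|lebesgue. recip (norm (f s - f x))) + boundary s b - boundary s a" (is ?eq)
proof -
  define \<rho> where "\<rho> = c * min \<bar>a\<bar> \<bar>b\<bar>"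
  have "0 < min \<bar>a\<bar> \<bar>b\<bar>" using zero ab by auto
  then have \<rho>: "\<rho> > 0" using c_pos by (simp add: \<rho>_def)
  let ?I = "{s + a..s + b}"
  let ?r = "\<lambda>x. norm (f s - f x)"
  let ?p = "\<lambda>x. (f s - f x) \<bullet> \<tau> s"
  have low: "\<rho> \<le> ?r x" if "x \<in> ?I" for x
  proof -
    have "min \<bar>a\<bar> \<bar>b\<bar> \<le> \<bar>x - s\<bar>" "\<bar>x - s\<bar> \<le> L / 2"
        using that range zero by auto
    then have "\<rho> \<le> c * \<bar>x - s\<bar>" unfolding \<rho>_def using c_pos
        by (intro mult_left_mono) auto
    also have "\<dots> \<le> ?r x" using chord_lower[OF \<open>\<bar>x - s\<bar>
        \<le> L / 2\<close>, of s] by simp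
    finally show ?thesis .
  qed
  have rlip: "1-lipschitz_on S ?r" for S
  proof (rule lipschitz_onI)
    fix x y
    have "\<bar>?r x - ?r y\<bar> \<le> norm ((f s - f x) - (f s - f y))" by (rule norm_triangle_ineq3)
    also have "\<dots> = dist (f x) (f y)" by (simp add: dist_norm norm_minus_commute)
    finally show "dist (?r x) (?r y) \<le> 1 * dist x y"
      using lipschitz_onD[OF f_lipschitz, of x y] by (simp add: dist_real_def)
  qed simp
  have tail_lip: "(1 / \<Phi> (\<rho> / 2))-lipschitz_on {\<rho> / 2<..} (tail \<Phi>)"
    using \<rho> by (intro lipschitz_on_subset[OF tail_lipschitz]) auto
  have tail_der: "(tail \<Phi> has_real_derivative - recip y) (at y)"
    if "y \<in> {\<rho> / 2<..}" "y \<notin> {x \<in> {0<..}. \<not> isCont \<Phi> x}" for y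
    using that \<rho> by (intro tail_has_derivative) auto
  obtain E where E: "countable E" "\<And>x d. \<lbrakk>x \<notin> E; ?r x \<in> {\<rho> / 2<..}; (?r
      has_real_derivative d) (at x)\<rbrakk> \<Longrightarrow>
    ((\<lambda>x. tail \<Phi> (?r x)) has_real_derivative - recip (?r x) * d) (at x)"
    using chain_rule_off_countable[OF open_greaterThan tail_lip countable_discontinuities tail_der, where
        r = ?r]
    by blast
  let ?F = "\<lambda>x. - (tail \<Phi> (?r x) * (1 / ?r x) * ?p x)"
  let ?F' = "\<lambda>x. M1 \<Phi> f s x + M2 \<Phi> f s x - recip (?r x)"
  have "\<exists>C. C-lipschitz_on ?I ?F"
  proof -
    have "(1 / \<Phi> \<rho> * 1)-lipschitz_on ?I (\<lambda>x. tail \<Phi> (?r x))"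
      using low by (intro lipschitz_on_compose2[OF rlip] lipschitz_on_subset[OF tail_lipschitz[OF
          \<rho>]]) auto
    moreover have "(1 / \<rho>\<^sup>2)-lipschitz_on ?I (\<lambda>x. 1 / ?r x)"
      by (rule lipschitz_on_inverse[OF rlip \<rho> low])
    ultimately obtain C1 where "C1-lipschitz_on ?I (\<lambda>x. tail \<Phi> (?r x) * (1 / ?r x))"
      using lipschitz_on_mult_compact[of ?I] by blast
    moreover have "(0 + 1 * norm (\<tau> s))-lipschitz_on ?I (\<lambda>x. f s \<bullet> \<tau> s
        - f x \<bullet> \<tau> s)"
      by (intro lipschitz_on_diff lipschitz_on_constant inner_lipschitz lipschitz_on_subset[OF
          f_lipschitz]) auto
    ultimately obtain C where "C-lipschitz_on ?I (\<lambda>x. tail \<Phi> (?r x) * (1 / ?r x) * (f s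
        \<bullet> \<tau> s - f x \<bullet> \<tau> s))"
      using lipschitz_on_mult_compact[of ?I] by blast
    then have "C-lipschitz_on ?I ?F" by (intro lipschitz_on_minus) (simp add: inner_diff_left)
    then show ?thesis by blast
  qed
  then obtain C where C: "C-lipschitz_on ?I ?F" by blast
  have "AE x in lebesgue. x \<notin> E"
    using E(1) by (intro AE_completion countable_imp_null_set_lborel[THEN AE_not_in])
  with tangent_eq AE_completion[OF \<tau>_derivative]
  have der: "AE x in lebesgue. s + a < x \<and> x < s + b \<longrightarrow>
      (?F has_real_derivative ?F' x) (at x)"
  proof eventually_elim
    case (elim x)
    show ?case
    proof
      assume "s + a < x \<and> x < s + b"
      then have "\<rho> \<le> ?r x" by (intro low) auto
      then have r: "?r x > 0" "?r x > \<rho> / 2" "f s \<noteq> f x" using \<rho> by auto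
      define q d where "q = (f s - f x) \<bullet> \<tau> x" and "d = \<tau> s \<bullet> \<tau> x"
      have r': "(?r has_real_derivative - q / ?r x) (at x)"
        unfolding q_def by (rule chord_has_derivative[OF elim(2) r(3)])
      have t': "((\<lambda>x. tail \<Phi> (?r x)) has_real_derivative - recip (?r x) * (- q / ?r x)) (at x)"
        using E(2)[OF elim(3) _ r'] r by simp
      have p': "(?p has_real_derivative - d) (at x)"
        using DERIV_diff[OF DERIV_const[of "f s \<bullet> \<tau> s"] has_real_derivative_inner[OF
            elim(2), of "\<tau> s"]]
        by (simp add: inner_diff_left inner_diff_right d_def inner_commute)
      have i': "((\<lambda>x. 1 / ?r x) has_real_derivative q / ?r x ^ 3) (at x)"
        using DERIV_inverse_fun[OF r'] r by (simp add: inverse_eq_divide field_simps eval_nat_numeral)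
      note F' = DERIV_minus[OF DERIV_mult[OF DERIV_mult[OF t' i'] p']]
      have unit: "\<tau> y \<bullet> \<tau> y = 1" for y using \<tau>_unit[of y]
          by (simp add: dot_square_norm)
      have M1: "M1 \<Phi> f s x = (1 - d) * recip (?r x)"
      proof -
        have "(norm (\<tau> s - \<tau> x))\<^sup>2 = 2 - 2 * d"
          by (simp add: power2_norm_eq_inner inner_diff_left inner_diff_right d_def unit inner_commute[of
              "\<tau> x"])
        then show ?thesis using r(1) Phi_pos[OF r(1)]
          unfolding M1_def s elim(1) recip_def by (simp add: diff_divide_distrib)
      qed
      have M2: "M2 \<Phi> f s x = (recip (?r x)
          + tail \<Phi> (?r x) / ?r x) * (d - ?p x * q / (?r x)\<^sup>2)"
      proof -
        let ?e = "(f s - f x) /\<^sub>R ?r x"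
        have e: "?e \<bullet> ?e = 1" using r(1) by (simp add: dot_square_norm power2_eq_square)
        have "\<tau> s \<bullet> ?e = ?p x / ?r x" "?e \<bullet> \<tau> x = q / ?r x"
          by (simp_all add: q_def inner_commute divide_inverse mult.commute)
        then have "wedge_inner (\<tau> s) ?e (\<tau> x) ?e = d - ?p x * q / (?r x)\<^sup>2"
          unfolding wedge_inner_def e d_def by (simp add: power2_eq_square)
        then show ?thesis using r(1)
          unfolding M2_def Let_def s elim(1) recip_def Lambda_eq_tail by simp
      qed
      have "?F' x = - ((- recip (?r x) * (- q / ?r x) * (1 / ?r x) + q / ?r x ^ 3 * tail \<Phi> (?r x)) * ?p x
            + - d * (tail \<Phi> (?r x) * (1 / ?r x)))"
        unfolding M1 M2 by (rule density_algebra[OF r(1)])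
      then show "(?F has_real_derivative ?F' x) (at x)" using F' by (simp only:)
    qed
  qed
  have ab': "s + a \<le> s + b" using ab by simp
  note F = lipschitz_fundamental_theorem[OF ab' C der]
  have F_boundary: "?F (s + h) = boundary s h" for h
    by (simp add: boundary_def Lambda_eq_tail)
  have rint: "set_integrable lebesgue ?I (\<lambda>x. recip (?r x))"
  proof -
    have "set_integrable lborel ?I (\<lambda>x. recip (?r x))"
    proof (rule set_integrable_bound)
      show "set_integrable lborel ?I (\<lambda>_. recip \<rho>)"
        unfolding set_integrable_def by (intro integrable_scaleR_left integrable_real_indicator) (auto
            simp: emeasure_lborel_Icc_eq)
      show "set_borel_measurable lborel ?I (\<lambda>x. recip (?r x))"
          by (auto simp: set_borel_measurable_def)
      show "AE x in lborel. x \<in> ?I \<longrightarrow> norm (recip (?r x)) \<le> norm (recip \<rho>)"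
        using recip_antimono[OF \<rho> low] recip_nonneg by (auto intro!: AE_I2)
    qed
    then show ?thesis by (rule set_integrable_lebesgue_of_lborel)
  qed
  have sum: "(\<lambda>x. ?F' x + recip (?r x)) = (\<lambda>x. M1 \<Phi> f s x + M2 \<Phi> f s x)" by auto
  show ?int using set_integral_add(1)[OF F(1) rint] unfolding sum .
  show ?eq using set_integral_add(2)[OF F(1) rint] F(2) unfolding sum F_boundary by simp
qed

end

section \<open>Symmetry of the boundary terms\<close>

lemma bounded_borel_lebesgue:
  fixes u :: "real \<Rightarrow> real"
  assumes "u \<in> borel_measurable borel" "\<And>x. \<bar>u x\<bar> \<le> B"
  shows "set_integrable lebesgue {a..b} u" "(LINT x:{a..b}|lebesgue. u x) = integral {a..b} u"
proof -
  show "set_integrable lebesgue {a..b} u"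
    by (rule set_integrable_lebesgue_of_lborel(1)[OF bounded_borel_set_integrable[OF assms]])
  then show "(LINT x:{a..b}|lebesgue. u x) = integral {a..b} u"
    by (rule set_lebesgue_integral_eq_integral(2))
qed

lemma integral_cong_AE_lborel:
  fixes u v :: "real \<Rightarrow> real"
  assumes "AE x in lborel. u x = v x"
  shows "integral S u = integral S v"
proof -
  obtain N where "negligible N" "\<And>x. x \<notin> N \<Longrightarrow> u x = v x"
    using AE_lebesgue_negligibleE[OF AE_completion[OF assms]] by blast
  then show ?thesis by (intro integral_spike[of N]) auto
qed

lemma integral_periodic_shift:
  fixes u :: "real \<Rightarrow> real"
  assumes u: "u \<in> borel_measurable borel" "\<And>x. \<bar>u x\<bar> \<le> B"
    and per: "AE s in lborel. u (s + L) = u s" and e: "0 \<le> e" "e \<le> L"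
  shows "integral {0..L} (\<lambda>s. u (s + e)) = integral {0..L} u"
proof -
  have ui: "u integrable_on {a..b}" for a b by (rule bounded_borel_integrable_on[OF u])
  have shift: "integral {a..b} (\<lambda>s. u (s + d)) = integral {a + d..b + d} u" for a b d
    using integral_shift_Icc_real[of a b u d] by (simp add: o_def add.commute)
  have "integral {0..L} (\<lambda>s. u (s + e)) = integral {e..L} u + integral {L..L + e} u"
    using shift[of 0 L e] Henstock_Kurzweil_Integration.integral_combine[of e L "L + e" u] e ui by simp
  also have "integral {L..L + e} u = integral {0..e} (\<lambda>s. u (s + L))"
    using shift[of 0 e L] by (simp add: add.commute)
  also have "\<dots> = integral {0..e} u" by (rule integral_cong_AE_lborel[OF per])
  finally show ?thesis
    using Henstock_Kurzweil_Integration.integral_combine[of 0 e L u] e ui by simp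
qed

lemma has_vector_derivative_shift:
  assumes "(f has_vector_derivative t) (at (x + e))"
  shows "((\<lambda>s. f (s + e)) has_vector_derivative t) (at x)"
proof -
  have "((\<lambda>s. s + e) has_vector_derivative 1) (at x)" by (auto intro!: derivative_eq_intros)
  from vector_diff_chain_at[OF this assms] show ?thesis by (simp add: o_def)
qed

context bilipschitz_arclength_curve
begin

lemma AE_derivative_shift: "AE s in lborel. (f has_vector_derivative \<tau> (s + e)) (at (s + e))"
  using AE_lborel_affine[OF _ \<tau>_derivative, of 1 e] by (simp add: add.commute)

lemma \<tau>_periodic: "AE s in lborel. \<tau> (s + L) = \<tau> s"
  using \<tau>_derivative AE_derivative_shift[of L]
proof eventually_elim
  case (elim s)
  have "(f has_vector_derivative \<tau> (s + L)) (at s)"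
    using has_vector_derivative_shift[OF elim(2)] by (simp add: f_periodic)
  then show ?case using elim(1) by (rule vector_derivative_unique_at)
qed

lemma tail_continuous: "0 < \<rho> \<Longrightarrow> continuous_on {\<rho>..} (tail \<Phi>)"
  using lipschitz_on_continuous_on[OF tail_lipschitz] .

lemma Lambda_continuous: "0 < \<rho> \<Longrightarrow> continuous_on {\<rho>..} (Lambda \<Phi>)"
  unfolding Lambda_eq_tail by (intro continuous_intros tail_continuous) auto

lemma Lambda_chord_continuous:
  assumes "h \<noteq> 0" "\<bar>h\<bar> \<le> L / 2"
  shows "continuous_on UNIV (\<lambda>s. Lambda \<Phi> (norm (f s - f (s + h))))"
proof (rule continuous_on_compose2[OF Lambda_continuous[of "c * \<bar>h\<bar>"]])
  show "continuous_on UNIV (\<lambda>s. norm (f s - f (s + h)))"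
    by (intro continuous_intros f_continuous continuous_on_compose2[OF f_continuous[of UNIV]]) auto
qed (use assms c_pos chord_lower in auto)

lemma boundary_measurable:
  assumes "h \<noteq> 0" "\<bar>h\<bar> \<le> L / 2"
  shows "(\<lambda>s. boundary s h) \<in> borel_measurable borel"
proof -
  have [measurable]: "(\<lambda>s. Lambda \<Phi> (norm (f s - f (s + h)))) \<in> borel_measurable borel"
    by (rule borel_measurable_continuous_onI[OF Lambda_chord_continuous[OF assms]])
  show ?thesis unfolding boundary_def by measurable
qed

lemma Lambda_chord_bound:
  assumes h: "0 < h0" "h0 \<le> \<bar>h\<bar>" "\<bar>h\<bar> \<le> L / 2"
  shows "\<bar>Lambda \<Phi> (norm (f s - f (s + h)))\<bar> * norm (f s - f (s + h))
      \<le> tail \<Phi> (c * h0)"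
proof -
  have pos: "0 < norm (f s - f (s + h))" using h by (intro chord_pos) auto
  have "c * h0 \<le> norm (f s - f (s + h))"
    using chord_lower[OF h(3), of s] mult_left_mono[OF h(2), of c] c_pos by linarith
  then have "tail \<Phi> (norm (f s - f (s + h))) \<le> tail \<Phi> (c * h0)"
    using c_pos h(1) by (intro tail_antimono) auto
  moreover have "\<bar>Lambda \<Phi> (norm (f s - f (s + h)))\<bar> * norm (f s - f (s + h))
      = tail \<Phi> (norm (f s - f (s + h)))"
    using pos tail_nonneg[OF pos] by (simp add: Lambda_eq_tail abs_mult abs_divide)
  ultimately show ?thesis by simp
qed

lemma Lambda_inner_bound:
  assumes h: "0 < h0" "h0 \<le> \<bar>h\<bar>" "\<bar>h\<bar> \<le> L / 2" and t: "norm t = 1"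
  shows "\<bar>Lambda \<Phi> (norm (f s - f (s + h))) * ((f s - f (s + h)) \<bullet> t)\<bar>
      \<le> tail \<Phi> (c * h0)"
proof -
  have "\<bar>(f s - f (s + h)) \<bullet> t\<bar> \<le> norm (f s - f (s + h))"
    using Cauchy_Schwarz_ineq2[of "f s - f (s + h)" t] t by simp
  then have "\<bar>Lambda \<Phi> (norm (f s - f (s + h))) * ((f s - f (s + h)) \<bullet> t)\<bar>
      \<le> \<bar>Lambda \<Phi> (norm (f s - f (s + h)))\<bar> * norm (f s - f (s + h))"
    unfolding abs_mult by (intro mult_left_mono) auto
  then show ?thesis using Lambda_chord_bound[OF h, of s] by linarith
qed

lemma boundary_bound:
  assumes "0 < h0" "h0 \<le> \<bar>h\<bar>" "\<bar>h\<bar> \<le> L / 2"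
  shows "\<bar>boundary s h\<bar> \<le> tail \<Phi> (c * h0)"
  unfolding boundary_def by (rule Lambda_inner_bound[OF assms \<tau>_unit])

lemma boundary_periodic: "AE s in lborel. boundary (s + L) h = boundary s h"
  using \<tau>_periodic
proof eventually_elim
  case (elim s)
  have "f (s + L + h) = f (s + h)" using f_periodic[of "s + h"] by (simp add: algebra_simps)
  then show ?case by (simp add: boundary_def f_periodic elim)
qed

text \<open>
  The two integrands differ by \<open>\<Lambda> r * r\<close> times the derivative of the chord
  length \<open>r s = norm (f s - f (s + e))\<close>. As \<open>\<Lambda> r * r = - tail r\<close>,
  this difference is the derivative of \<open>- K (r s)\<close> for a primitive \<open>K\<close> of
  the tail, and it integrates to \<open>0\<close> over a period.
\<close>

lemma integral_chord_increment:
  assumes e: "0 < e" "e \<le> L / 2"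
  shows "integral {0..L} (\<lambda>s. Lambda \<Phi> (norm (f s - f (s + e))) * ((f s - f (s
      + e)) \<bullet> \<tau> s))
       = integral {0..L} (\<lambda>s. Lambda \<Phi> (norm (f s - f (s + e))) * ((f s - f (s
           + e)) \<bullet> \<tau> (s + e)))"
proof -
  let ?r = "\<lambda>s. norm (f s - f (s + e))"
  define \<rho> where "\<rho> = c * e"
  have \<rho>: "\<rho> > 0" using e c_pos by (simp add: \<rho>_def)
  have r: "\<rho> \<le> ?r s" "?r s \<le> e" for s
    using chord_lower[of e s] chord_upper[of s e] e by (auto simp: \<rho>_def)
  define K where "K x = integral {\<rho> / 2..x} (tail \<Phi>)" for x
  have K: "(K has_real_derivative tail \<Phi> x) (at x)" if "x \<in> {\<rho>..e}" for x
  proof -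
    have D: "(K has_real_derivative tail \<Phi> x) (at x within {\<rho> / 2..e + 1})"
      unfolding K_def using that \<rho>
      by (intro integral_has_real_derivative continuous_on_subset[OF tail_continuous[of "\<rho> / 2"]]) auto
    have "x \<in> interior {\<rho> / 2..e + 1}" using that \<rho> by simp
    from D[unfolded at_within_interior[OF this]] show ?thesis .
  qed
  have Klip: "(tail \<Phi> \<rho>)-lipschitz_on {\<rho>..e} K"
  proof (rule lipschitz_onI)
    fix x y assume xy: "x \<in> {\<rho>..e}" "y \<in> {\<rho>..e}"
    have "norm (K x - K y) \<le> tail \<Phi> \<rho> * norm (x - y)"
    proof (rule field_differentiable_bound[OF _ _ _ xy])
      show "(K has_real_derivative tail \<Phi> z) (at z within {\<rho>..e})" if "z \<in> {\<rho>..e}" for z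
        using K[OF that] by (rule DERIV_subset) simp
      show "norm (tail \<Phi> z) \<le> tail \<Phi> \<rho>" if "z \<in> {\<rho>..e}" for z
        using that tail_antimono[OF \<rho>, of z] tail_nonneg[of z] \<rho> by simp
    qed simp
    then show "dist (K x) (K y) \<le> tail \<Phi> \<rho> * dist x y" by (simp add: dist_norm)
  qed (use tail_nonneg \<rho> in auto)
  have rlip: "2-lipschitz_on S ?r" for S
  proof (rule lipschitz_onI)
    fix x y
    have "\<bar>?r x - ?r y\<bar> \<le> norm ((f x - f (x + e)) - (f y - f (y + e)))"
        by (rule norm_triangle_ineq3)
    also have "\<dots> = norm ((f x - f y) - (f (x + e) - f (y + e)))" by (simp add: algebra_simps)
    also have "\<dots> \<le> norm (f x - f y) + norm (f (x + e) - f (y + e))" by (rule norm_triangle_ineq4)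
    also have "\<dots> \<le> \<bar>x - y\<bar> + \<bar>x - y\<bar>"
      using lipschitz_onD[OF f_lipschitz, of x y] lipschitz_onD[OF f_lipschitz, of "x + e" "y + e"]
      by (intro add_mono) (auto simp: dist_norm)
    finally show "dist (?r x) (?r y) \<le> 2 * dist x y" by (simp add: dist_real_def)
  qed simp
  have lip: "(tail \<Phi> \<rho> * 2)-lipschitz_on {0..L} (\<lambda>s. K (?r s))"
    using r by (intro lipschitz_on_compose2[OF rlip] lipschitz_on_subset[OF Klip]) auto
  let ?d = "\<lambda>s. Lambda \<Phi> (?r s) * ((f s - f (s + e)) \<bullet> (\<tau> s - \<tau> (s + e)))"
  have "AE s in lebesgue. 0 < s \<and> s < L \<longrightarrow>
      ((\<lambda>s. K (?r s)) has_real_derivative - ?d s) (at s)"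
    using AE_completion[OF \<tau>_derivative] AE_completion[OF AE_derivative_shift[of e]]
  proof eventually_elim
    case (elim s)
    have pos: "?r s > 0" using r(1)[of s] \<rho> by linarith
    have "((\<lambda>s. f s - f (s + e)) has_vector_derivative \<tau> s - \<tau> (s + e)) (at s)"
      by (intro has_vector_derivative_diff elim(1) has_vector_derivative_shift elim(2))
    then have "(?r has_real_derivative ((f s - f (s + e)) \<bullet> (\<tau> s - \<tau> (s
        + e))) / ?r s) (at s)"
      by (rule norm_has_real_derivative) (use pos in auto)
    with K[of "?r s"] have "((\<lambda>s. K (?r s)) has_real_derivative tail \<Phi> (?r s) * (((f s
        - f (s + e)) \<bullet> (\<tau> s - \<tau> (s + e))) / ?r s)) (at s)"
      using r by (intro DERIV_chain2[where f = K and g = ?r]) auto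
    then show ?case by (simp add: Lambda_eq_tail)
  qed
  note F = lipschitz_fundamental_theorem[OF _ lip this]
  have "f (L + e) = f e" using f_periodic[of e] by (simp add: add.commute)
  moreover have "f L = f 0" using f_periodic[of 0] by simp
  ultimately have "(LINT s:{0..L}|lebesgue. - ?d s) = 0" using F(2) L_pos by simp
  then have zero: "integral {0..L} (\<lambda>s. - ?d s) = 0"
    using F(1) L_pos by (simp add: set_lebesgue_integral_eq_integral(2))
  have [measurable]: "(\<lambda>s. Lambda \<Phi> (?r s)) \<in> borel_measurable borel"
    using e by (intro borel_measurable_continuous_onI Lambda_chord_continuous) auto
  have i1: "(\<lambda>s. Lambda \<Phi> (?r s) * ((f s - f (s + e)) \<bullet> \<tau> s)) integrable_on {0..L}"
    using e by (intro bounded_borel_integrable_on[OF _ Lambda_inner_bound[of e e _ , OF _ _ _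
        \<tau>_unit]]) auto
  have i2: "(\<lambda>s. Lambda \<Phi> (?r s) * ((f s - f (s + e)) \<bullet> \<tau> (s
      + e))) integrable_on {0..L}"
    using e by (intro bounded_borel_integrable_on[OF _ Lambda_inner_bound[of e e _ , OF _ _ _
        \<tau>_unit]]) auto
  have "(\<lambda>s. - ?d s) = (\<lambda>s. Lambda \<Phi> (?r s) * ((f s - f (s
      + e)) \<bullet> \<tau> (s + e)) - Lambda \<Phi> (?r s) * ((f s - f (s + e)) \<bullet> \<tau> s))"
    by (auto simp: inner_diff_right algebra_simps)
  then show ?thesis using zero Henstock_Kurzweil_Integration.integral_diff[OF i2 i1] by simp
qed

text \<open>
  Moving the base point by \<open>e\<close> turns the left end point of a window into a right one,
  but with the tangent taken at the other end of the chord.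
\<close>

lemma integral_boundary_minus:
  assumes e: "0 < e" "e \<le> L / 2"
  shows "integral {0..L} (\<lambda>s. boundary s (- e)) = - integral {0..L} (\<lambda>s. boundary s e)"
proof -
  have "integral {0..L} (\<lambda>s. boundary s (- e)) = integral {0..L} (\<lambda>s. boundary (s + e) (- e))"
  proof (rule integral_periodic_shift[symmetric])
    show "(\<lambda>s. boundary s (- e)) \<in> borel_measurable borel" using e
        by (intro boundary_measurable) auto
    show "\<bar>boundary s (- e)\<bar> \<le> tail \<Phi> (c * e)" for s using e by (intro boundary_bound) auto
    show "AE s in lborel. boundary (s + L) (- e) = boundary s (- e)" by (rule boundary_periodic)
  qed (use e L_pos in auto)
  also have "(\<lambda>s. boundary (s + e) (- e))
      = (\<lambda>s. - (Lambda \<Phi> (norm (f s - f (s + e))) * ((f s - f (s + e)) \<bullet> \<tau> (s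
          + e))))"
    by (auto simp: boundary_def norm_minus_commute inner_diff_left algebra_simps)
  also have "integral {0..L} \<dots> = - integral {0..L} (\<lambda>s. boundary s e)"
    using integral_chord_increment[OF e] by (simp add: boundary_def)
  finally show ?thesis .
qed

end

section \<open>The energy as a limit over windows\<close>

lemma nn_integral_periodic_window:
  fixes p :: "real \<Rightarrow> ennreal"
  assumes p[measurable]: "p \<in> borel_measurable borel" and per: "\<And>s. p (s + L) = p s"
    and a: "- L \<le> a" "a \<le> L"
  shows "(\<integral>\<^sup>+s\<in>{a..a + L}. p s \<partial>lborel)
      = (\<integral>\<^sup>+s\<in>{0..L}. p s \<partial>lborel)"
proof -
  define W where "W x y = (\<integral>\<^sup>+s\<in>{x..<y}. p s \<partial>lborel)" for x y
  have closed: "(\<integral>\<^sup>+s\<in>{x..y}. p s \<partial>lborel) = W x y" for x y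
    unfolding W_def by (intro nn_integral_cong_AE AE_I[where N="{y}"]) (auto simp: indicator_def)
  have add: "W x y + W y z = W x z" if "x \<le> y" "y \<le> z" for x y z
  proof -
    have "W x y + W y z = (\<integral>\<^sup>+s. p s * indicator {x..<y} s
        + p s * indicator {y..<z} s \<partial>lborel)"
      unfolding W_def by (intro nn_integral_add[symmetric]) auto
    also have "\<dots> = W x z" unfolding W_def
      using that by (intro nn_integral_cong) (auto simp: indicator_def)
    finally show ?thesis .
  qed
  have shift: "W (x + L) (y + L) = W x y" for x y
  proof -
    have "W (x + L) (y + L) = (\<integral>\<^sup>+s. p (L + 1 * s) * indicator {x + L..<y + L} (L
        + 1 * s) \<partial>lborel)"
      unfolding W_def using nn_integral_real_affine[of "\<lambda>s. p s * indicator {x + L..<y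
          + L} s" 1 L] by simp
    also have "\<dots> = W x y"
      unfolding W_def by (intro nn_integral_cong) (auto simp: indicator_def per add.commute[of L])
    finally show ?thesis .
  qed
  have pos: "W a (a + L) = W 0 L" if "0 \<le> a" "a \<le> L" for a
  proof -
    have "W a (a + L) = W a L + W (0 + L) (a + L)" using add[of a L "a + L"] that by simp
    also have "W (0 + L) (a + L) = W 0 a" by (rule shift)
    also have "W a L + W 0 a = W 0 L" using add[of 0 a L] that by (simp add: add.commute)
    finally show ?thesis .
  qed
  have "W a (a + L) = W 0 L"
  proof (cases "0 \<le> a")
    case True
    then show ?thesis using pos a by simp
  next
    case False
    then show ?thesis using pos[of "a + L"] shift[of a "a + L"] a by simp
  qed
  then show ?thesis by (simp add: closed)
qed

lemma tendsto_lebesgue_integral_at_right_0: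
  fixes F :: "real \<Rightarrow> 'a \<Rightarrow> real"
  assumes b: "0 < b" and w: "integrable M w" and f: "f \<in> borel_measurable M"
    and meas: "\<And>e. \<lbrakk>0 < e; e < b\<rbrakk> \<Longrightarrow> F e \<in> borel_measurable M"
    and bound: "\<And>e. \<lbrakk>0 < e; e < b\<rbrakk> \<Longrightarrow> AE x in M. norm (F e x) \<le> w x"
    and lim: "AE x in M. ((\<lambda>e. F e x) \<longlongrightarrow> f x) (at_right 0)"
  shows "((\<lambda>e. integral\<^sup>L M (F e)) \<longlongrightarrow> integral\<^sup>L M f) (at_right 0)"
proof (rule tendsto_at_right_sequentially[OF b])
  fix S :: "nat \<Rightarrow> real"
  assume S: "\<And>n. 0 < S n" "\<And>n. S n < b" "S \<longlonglongrightarrow> 0"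
  have S0: "filterlim S (at_right 0) sequentially"
    using S by (intro tendsto_imp_filterlim_at_right) auto
  show "(\<lambda>n. integral\<^sup>L M (F (S n))) \<longlonglongrightarrow> integral\<^sup>L M f"
  proof (rule integral_dominated_convergence[where w = w, OF f _ w])
    show "AE x in M. (\<lambda>n. F (S n) x) \<longlonglongrightarrow> f x"
      using lim by eventually_elim (rule filterlim_compose[OF _ S0])
  qed (use S meas bound in auto)
qed

context energy_kernel
begin

lemma tail_diff_recip:
  assumes "0 < x" "x \<le> y"
  shows "set_integrable lborel {x..y} recip" "(LINT t:{x..y}|lborel. recip t) = tail \<Phi> x - tail \<Phi> y"
proof -
  have eq: "indicator {x..y} t *\<^sub>R (1 / \<Phi> t) = indicator {x..y} t *\<^sub>R recip t" for t
    using assms by (auto simp: indicator_def recip_def)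
  have "set_integrable lebesgue {x..y} (\<lambda>t. 1 / \<Phi> t)"
    using assms by (intro set_integrable_subset[OF Phi_integrable[of x]]) auto
  then have "integrable lebesgue (\<lambda>t. indicator {x..y} t *\<^sub>R recip t)"
    unfolding set_integrable_def eq .
  then show int: "set_integrable lborel {x..y} recip"
    unfolding set_integrable_def by (subst (asm) integrable_completion) auto
  show "(LINT t:{x..y}|lborel. recip t) = tail \<Phi> x - tail \<Phi> y"
    unfolding tail_diff_bounds(1)[OF assms] set_integrable_lebesgue_of_lborel(2)[OF int, symmetric]
    unfolding set_lebesgue_integral_def eq ..
qed

end

context bilipschitz_arclength_curve
begin

text \<open>
  The energy density in the coordinates base point and offset, where the distance along the curve
  becomes \<open>\<bar>h\<bar>\<close>.
\<close>

definition excess :: "real \<times> real \<Rightarrow> real" where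
  "excess x = indicator ({0..L} \<times> {- (L / 2)..L / 2}) x
     * (recip (norm (f (fst x) - f (fst x + snd x))) - recip \<bar>snd x\<bar>)"

lemma excess_measurable[measurable]: "excess \<in> borel_measurable borel"
proof -
  have [measurable]: "(\<lambda>x. f (fst x) - f (fst x + snd x)) \<in> borel_measurable borel"
    by (intro borel_measurable_continuous_onI continuous_intros continuous_on_compose2[OF f_continuous[of
        UNIV]]) auto
  have [measurable]: "(\<lambda>x::real \<times> real. \<bar>snd x\<bar>) \<in> borel_measurable borel"
    by (intro borel_measurable_continuous_onI continuous_intros)
  have [measurable]: "{0..L} \<times> {- (L / 2)..L / 2} \<in> sets (borel :: (real \<times> real) measure)"
    by (intro borel_closed closed_Times) auto
  show ?thesis unfolding excess_def[abs_def] by measurable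
qed

lemma excess_nonneg: "0 \<le> excess x"
proof (cases "x \<in> {0..L} \<times> {- (L / 2)..L / 2}")
  case True
  obtain s h where x: "x = (s, h)" by force
  then have h: "\<bar>h\<bar> \<le> L / 2" using True by auto
  show ?thesis
  proof (cases "h = 0")
    case True
    then show ?thesis by (simp add: excess_def x)
  next
    case False
    then show ?thesis using recip_antimono[OF chord_pos[OF False h] chord_upper, of s]
      by (simp add: excess_def x)
  qed
qed (simp add: excess_def)

lemma energy_eq_excess: "energy L \<Phi> f = (\<integral>\<^sup>+x. ennreal (excess x) \<partial>lborel)"
proof -
  \<comment> \<open>On the diagonal both terms of the energy density are \<open>1 / \<Phi> 0\<close>, and
      they cancel.\<close>
  define \<psi> where "\<psi> x = recip x + (1 / \<Phi> 0) * indicator {0} x" for x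
  have [measurable]: "\<psi> \<in> borel_measurable borel" unfolding \<psi>_def by measurable
  have \<psi>: "1 / \<Phi> x = \<psi> x" if "0 \<le> x" for x using that
      by (auto simp: \<psi>_def recip_def indicator_def)
  have cd0: "0 \<le> circle_dist L s t" for s t unfolding circle_dist_def by (rule cINF_greatest) auto
  define g where "g x = ennreal (\<psi> (norm (f (fst x) - f (snd x)))
      - \<psi> (circle_dist L (fst x) (snd x)))" for x
  note circle_dist_measurable[measurable]
  have [measurable]: "(\<lambda>x. f (fst x) - f (snd x)) \<in> borel_measurable borel"
    by (intro borel_measurable_continuous_onI continuous_intros continuous_on_compose2[OF f_continuous[of
        UNIV]]) auto
  have g[measurable]: "g \<in> borel_measurable borel" unfolding g_def by measurable
  have [measurable]: "{0..L} \<times> {0..L} \<in> sets (borel :: (real \<times> real) measure)"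
    by (intro borel_closed closed_Times) auto
  let ?q = "\<lambda>x. g x * indicator ({0..L} \<times> {0..L}) x"
  have q: "?q \<in> borel_measurable (lborel \<Otimes>\<^sub>M lborel)" unfolding lborel_prod by measurable
  have ex: "(\<lambda>x. ennreal (excess x)) \<in> borel_measurable (lborel \<Otimes>\<^sub>M lborel)"
      unfolding lborel_prod by measurable
  have "energy L \<Phi> f = (\<integral>\<^sup>+x. ?q x \<partial>lborel)"
    unfolding energy_def nn_integral_completion
    by (intro nn_integral_cong) (auto simp: g_def \<psi> cd0 split: prod.split)
  also have "\<dots> = (\<integral>\<^sup>+s. (\<integral>\<^sup>+t. ?q (s, t) \<partial>lborel)
      \<partial>lborel)"
    using lborel.nn_integral_fst[OF q] by (simp add: lborel_prod)
  also have "\<dots> = (\<integral>\<^sup>+s. (\<integral>\<^sup>+h. ennreal (excess (s, h))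
      \<partial>lborel) \<partial>lborel)"
  proof (rule nn_integral_cong)
    fix s :: real
    show "(\<integral>\<^sup>+t. ?q (s, t) \<partial>lborel)
        = (\<integral>\<^sup>+h. ennreal (excess (s, h)) \<partial>lborel)"
    proof (cases "s \<in> {0..L}")
      case False
      then have "?q (s, t) = 0" "excess (s, t) = 0" for t by (auto simp: excess_def)
      then show ?thesis by (simp only: ennreal_0 nn_integral_const mult_zero_left)
    next
      case True
      have gs[measurable]: "(\<lambda>t. g (s, t)) \<in> borel_measurable borel"
        by (rule measurable_compose[OF _ g]) (auto intro!: borel_measurable_continuous_onI continuous_intros)
      have "(\<integral>\<^sup>+t. ?q (s, t) \<partial>lborel)
          = (\<integral>\<^sup>+t\<in>{0..L}. g (s, t) \<partial>lborel)"
        using True by (intro nn_integral_cong) (auto simp: indicator_def)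
      also have "\<dots> = (\<integral>\<^sup>+t\<in>{s - L / 2..s - L / 2 + L}. g (s, t) \<partial>lborel)"
        using True L_pos
        by (intro nn_integral_periodic_window[symmetric] gs) (auto simp: g_def f_periodic
            circle_dist_periodic)
      also have "\<dots> = (\<integral>\<^sup>+h. g (s, s + 1 * h) * indicator {s - L / 2..s - L / 2
          + L} (s + 1 * h) \<partial>lborel)"
        using nn_integral_real_affine[of "\<lambda>t. g (s, t) * indicator {s - L / 2..s - L / 2
            + L} t" 1 s] by simp
      also have "\<dots> = (\<integral>\<^sup>+h. ennreal (excess (s, h)) \<partial>lborel)"
      proof (rule nn_integral_cong)
        fix h :: real
        show "g (s, s + 1 * h) * indicator {s - L / 2..s - L / 2 + L} (s + 1 * h) = ennreal (excess (s, h))"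
        proof (cases "\<bar>h\<bar> \<le> L / 2")
          case False
          then show ?thesis by (auto simp: excess_def indicator_def abs_le_iff)
        next
          case h: True
          then have "circle_dist L s (s + h) = \<bar>h\<bar>" by (rule circle_dist_shift[OF L_pos])
          moreover have "\<psi> (norm (f s - f (s + h))) - \<psi> \<bar>h\<bar>
              = recip (norm (f s - f (s + h))) - recip \<bar>h\<bar>"
            using chord_pos[OF _ h, of s] by (cases "h = 0") (auto simp: \<psi>_def indicator_def)
          moreover have "h \<in> {- (L / 2)..L / 2}" "s + h \<in> {s - L / 2..s - L / 2 + L}" using h by auto
          ultimately show ?thesis using True by (simp add: g_def excess_def)
        qed
      qed
      finally show ?thesis .
    qed
  qed
  also have "\<dots> = (\<integral>\<^sup>+x. ennreal (excess x) \<partial>lborel)"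
    using lborel.nn_integral_fst[OF ex] by (simp add: lborel_prod)
  finally show ?thesis .
qed

definition window :: "real \<Rightarrow> real set" where
  "window e = {- (L / 2 - e)..- e} \<union> {e..L / 2 - e}"

lemma window_measurable[measurable]: "window e \<in> sets borel"
  unfolding window_def by measurable

lemma window_const_integrable: "set_integrable lborel (window e) (\<lambda>_. k :: real)"
proof -
  have "emeasure lborel (window e) \<le> emeasure lborel {- (L / 2 - e)..- e}
      + emeasure lborel {e..L / 2 - e}"
    unfolding window_def by (rule emeasure_subadditive) auto
  also have "\<dots> < \<infinity>" by (auto simp: emeasure_lborel_Icc_eq ennreal_add_eq_top less_top)
  finally show ?thesis
    unfolding set_integrable_def by (intro integrable_scaleR_left integrable_real_indicator) auto
qed

definition chord_integral :: "real \<Rightarrow> real \<Rightarrow> real" where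
  "chord_integral e s = (LINT h:window e|lborel. recip (norm (f s - f (s + h))))"

lemma chord_recip_bound:
  assumes "0 < e" "h \<in> window e"
  shows "recip (norm (f s - f (s + h))) \<le> recip (c * e)"
proof -
  have h: "e \<le> \<bar>h\<bar>" "\<bar>h\<bar> \<le> L / 2" using assms by (auto simp: window_def)
  have "c * e \<le> c * \<bar>h\<bar>" using h(1) c_pos by (intro mult_left_mono) auto
  also have "\<dots> \<le> norm (f s - f (s + h))" by (rule chord_lower[OF h(2)])
  finally show ?thesis using assms(1) c_pos by (intro recip_antimono) auto
qed

lemma chord_recip_integrable:
  assumes e: "0 < e"
  shows "set_integrable lborel (window e) (\<lambda>h. recip (norm (f s - f (s + h))))"
proof (rule set_integrable_bound)
  show "set_integrable lborel (window e) (\<lambda>_. recip (c * e))"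
    by (rule window_const_integrable)
  show "set_borel_measurable lborel (window e) (\<lambda>h. recip (norm (f s - f (s + h))))"
    unfolding set_borel_measurable_def by measurable
  show "AE h in lborel. h \<in> window e \<longrightarrow> norm (recip (norm (f s - f (s + h))))
      \<le> norm (recip (c * e))"
    using chord_recip_bound[OF e] recip_nonneg by (auto intro!: AE_I2)
qed

lemma abs_chord_integral_le:
  assumes e: "0 < e"
  shows "\<bar>chord_integral e s\<bar> \<le> (LINT h:window e|lborel. recip (c * e))"
proof -
  note const = window_const_integrable[of e "recip (c * e)"]
  have "0 \<le> chord_integral e s"
    unfolding chord_integral_def set_lebesgue_integral_def
    by (intro Bochner_Integration.integral_nonneg) (auto simp: recip_nonneg)
  moreover have "chord_integral e s \<le> (LINT h:window e|lborel. recip (c * e))"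
    unfolding chord_integral_def
    by (intro set_integral_mono chord_recip_integrable const e chord_recip_bound)
  ultimately show ?thesis by simp
qed

lemma chord_integral_measurable[measurable]: "chord_integral e \<in> borel_measurable borel"
proof -
  have [measurable]: "(\<lambda>x. f (fst x) - f (fst x + snd x)) \<in> borel_measurable borel"
    by (intro borel_measurable_continuous_onI continuous_intros continuous_on_compose2[OF f_continuous[of
        UNIV]]) auto
  have "(snd :: real \<times> real \<Rightarrow> real) \<in> borel_measurable borel"
    by (intro borel_measurable_continuous_onI continuous_intros)
  then have [measurable]: "(\<lambda>x::real \<times> real. indicator (window e) (snd x) :: real) \<in>
      borel_measurable borel"
    by (rule measurable_compose) measurable
  have "(\<lambda>x. indicator (window e) (snd x) *\<^sub>R recip (norm (f (fst x) - f (fst x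
      + snd x)))) \<in> borel_measurable borel"
    by measurable
  then have "(\<lambda>(s, h). indicator (window e) h *\<^sub>R recip (norm (f s - f (s
      + h)))) \<in> borel_measurable (lborel \<Otimes>\<^sub>M lborel)"
    unfolding lborel_prod split_beta' by simp
  from lborel.borel_measurable_lebesgue_integral[OF this]
  show ?thesis unfolding chord_integral_def[abs_def] set_lebesgue_integral_def by simp
qed

lemma chord_integral_eq:
  assumes e: "0 < e" "e < L / 4"
  shows "chord_integral e s = (LINT x:{s + (e - L / 2)..s + - e}|lebesgue. recip (norm (f s - f x)))
    + (LINT x:{s + e..s + (L / 2 - e)}|lebesgue. recip (norm (f s - f x)))"
proof -
  let ?u = "\<lambda>h. recip (norm (f s - f (s + h)))"
  have sub: "set_integrable lborel {a..b} ?u" if "{a..b} \<subseteq> window e" for a b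
    using set_integrable_subset[OF chord_recip_integrable[OF e(1)]] that by simp
  have shift: "(LINT x:{s + a..s + b}|lebesgue. recip (norm (f s - f x)))
      = (LINT h:{a..b}|lborel. ?u h)" for a b
  proof -
    have "(LINT x:{s + a..s + b}|lebesgue. recip (norm (f s - f x)))
        = (LINT x:{s + a..s + b}|lborel. recip (norm (f s - f x)))"
      unfolding set_lebesgue_integral_def by (intro integral_completion) measurable
    also have "\<dots> = (LINT h|lborel. indicator {s + a..s + b} (s
        + 1 * h) *\<^sub>R recip (norm (f s - f (s + 1 * h))))"
      unfolding set_lebesgue_integral_def
      using lborel_integral_real_affine[of 1 "\<lambda>x. indicator {s + a..s
          + b} x *\<^sub>R recip (norm (f s - f x))" s] by simp
    also have "\<dots> = (LINT h:{a..b}|lborel. ?u h)"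
      unfolding set_lebesgue_integral_def
          by (intro Bochner_Integration.integral_cong) (auto simp: indicator_def)
    finally show ?thesis .
  qed
  have "chord_integral e s = (LINT h:{e - L / 2..- e}|lborel. ?u h) + (LINT h:{e..L / 2 - e}|lborel. ?u h)"
    unfolding chord_integral_def window_def
    using e sub[of "- (L / 2 - e)" "- e"] sub[of e "L / 2 - e"]
    by (subst set_integral_Un) (auto simp: window_def)
  then show ?thesis by (simp only: shift)
qed

lemma recip_window_integral:
  assumes e: "0 < e" "e < L / 4"
  shows "set_integrable lborel (window e) (\<lambda>h. recip \<bar>h\<bar>)"
    and "(LINT h:window e|lborel. recip \<bar>h\<bar>) = 2 * (tail \<Phi> e - tail \<Phi> (L / 2 - e))"
proof -
  let ?I = "{e..L / 2 - e}"
  have eq: "indicator ?I h *\<^sub>R recip \<bar>h\<bar> = indicator ?I h *\<^sub>R recip h" for h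
    using e by (auto simp: indicator_def)
  have p: "set_integrable lborel ?I (\<lambda>h. recip \<bar>h\<bar>)" "(LINT h:?I|lborel. recip
      \<bar>h\<bar>) = tail \<Phi> e - tail \<Phi> (L / 2 - e)"
    using tail_diff_recip[of e "L / 2 - e"] e
        unfolding set_integrable_def set_lebesgue_integral_def eq by auto
  have refl: "indicator {- (L / 2 - e)..- e} (0 + -1 * h) *\<^sub>R recip \<bar>0 + -1 * h\<bar>
      = indicator ?I h *\<^sub>R recip \<bar>h\<bar>" for h
    by (auto simp: indicator_def)
  have n: "set_integrable lborel {- (L / 2 - e)..- e} (\<lambda>h. recip \<bar>h\<bar>)"
    using p(1) lborel_integrable_real_affine_iff[of "-1" "\<lambda>h. indicator {- (L / 2
        - e)..- e} h *\<^sub>R recip \<bar>h\<bar>" 0]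
    unfolding set_integrable_def refl by simp
  have n': "(LINT h:{- (L / 2 - e)..- e}|lborel. recip \<bar>h\<bar>)
      = tail \<Phi> e - tail \<Phi> (L / 2 - e)"
    using p(2) lborel_integral_real_affine[of "-1" "\<lambda>h. indicator {- (L / 2
        - e)..- e} h *\<^sub>R recip \<bar>h\<bar>" 0]
    unfolding set_lebesgue_integral_def refl by simp
  show "set_integrable lborel (window e) (\<lambda>h. recip \<bar>h\<bar>)"
    unfolding window_def by (intro set_integrable_Un n p) auto
  show "(LINT h:window e|lborel. recip \<bar>h\<bar>) = 2 * (tail \<Phi> e - tail \<Phi> (L / 2 - e))"
  proof -
    have "{- (L / 2 - e)..- e} \<inter> ?I = {}" using e by auto
    from set_integral_Un[OF this n p(1)] show ?thesis unfolding window_def n' p(2) by simp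
  qed
qed

end

section \<open>The principal value\<close>

context bilipschitz_arclength_curve
begin

abbreviation boundary_integral :: "real \<Rightarrow> real" where
  "boundary_integral h \<equiv> integral {0..L} (\<lambda>s. boundary s h)"

lemma excess_window_measurable:
  "(\<lambda>x. excess x * indicator (window e) (snd x)) \<in> borel_measurable borel"
proof -
  have "(snd :: real \<times> real \<Rightarrow> real) \<in> borel_measurable borel"
    by (intro borel_measurable_continuous_onI continuous_intros)
  then have [measurable]: "(\<lambda>x::real \<times> real. indicator (window e) (snd x) :: real) \<in>
      borel_measurable borel"
    by (rule measurable_compose) measurable
  show ?thesis by measurable
qed

lemma integral_excess_window:
  assumes ex: "integrable lborel excess" and e: "0 < e" "e < L / 4"
  shows "(LINT x|lborel. excess x * indicator (window e) (snd x))
    = integral {0..L} (chord_integral e) - 2 * L * (tail \<Phi> e - tail \<Phi> (L / 2 - e))"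
proof -
  let ?k = "2 * (tail \<Phi> e - tail \<Phi> (L / 2 - e))"
  let ?w = "\<lambda>x. excess x * indicator (window e) (snd x)"
  have "integrable lborel ?w"
  proof (rule Bochner_Integration.integrable_bound[OF ex])
    show "?w \<in> borel_measurable lborel" using excess_window_measurable by simp
    show "AE x in lborel. norm (?w x) \<le> norm (excess x)" by (intro AE_I2) (simp add: indicator_def)
  qed
  then have w: "integrable (lborel \<Otimes>\<^sub>M lborel) ?w" by (simp add: lborel_prod)
  have inner: "(LINT h|lborel. ?w (s, h)) = indicator {0..L} s *\<^sub>R (chord_integral e s - ?k)" for s
  proof -
    have "?w (s, h) = indicator {0..L} s *
        (indicator (window e) h *\<^sub>R recip (norm (f s - f (s
            + h))) - indicator (window e) h *\<^sub>R recip \<bar>h\<bar>)" for h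
    proof (cases "h \<in> window e")
      case True
      then have "h \<in> {- (L / 2)..L / 2}" using e by (auto simp: window_def)
      then show ?thesis using True by (auto simp: excess_def indicator_def)
    qed simp
    then have "(LINT h|lborel. ?w (s, h)) = indicator {0..L} s * (LINT h|lborel.
        (indicator (window e) h *\<^sub>R recip (norm (f s - f (s
            + h))) - indicator (window e) h *\<^sub>R recip \<bar>h\<bar>))"
      by (simp only: integral_mult_right_zero)
    also have "(LINT h|lborel. (indicator (window e) h *\<^sub>R recip (norm (f s - f (s
        + h))) - indicator (window e) h *\<^sub>R recip \<bar>h\<bar>))
        = chord_integral e s - ?k"
      using Bochner_Integration.integral_diff[OF chord_recip_integrable[OF e(1), unfolded
          set_integrable_def, of s]
          recip_window_integral(1)[OF e, unfolded set_integrable_def]] recip_window_integral(2)[OF e]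
      by (simp only: chord_integral_def set_lebesgue_integral_def)
    finally show ?thesis by simp
  qed
  have ci: "set_integrable lborel {0..L} (chord_integral e)"
    by (rule bounded_borel_set_integrable[OF chord_integral_measurable abs_chord_integral_le[OF e(1)]])
  have const: "set_integrable lborel {0..L} (\<lambda>_. ?k)"
    by (rule bounded_borel_set_integrable[where B = "\<bar>?k\<bar>"]) auto
  have "(LINT x|lborel. ?w x) = (LINT s|lborel. (LINT h|lborel. ?w (s, h)))"
    using lborel_pair.integral_fst'[OF w] by (simp add: lborel_prod)
  also have "\<dots> = (LINT s:{0..L}|lborel. chord_integral e s - ?k)"
    unfolding inner set_lebesgue_integral_def ..
  also have "\<dots> = (LINT s:{0..L}|lborel. chord_integral e s) - (LINT s:{0..L}|lborel. ?k)"
    by (rule set_integral_diff(2)[OF ci const])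
  also have "(LINT s:{0..L}|lborel. chord_integral e s) = integral {0..L} (chord_integral e)"
    by (rule set_borel_integral_eq_integral(2)[OF ci])
  also have "(LINT s:{0..L}|lborel. ?k) = L * ?k"
    using set_borel_integral_eq_integral(2)[OF const] L_pos by simp
  finally show ?thesis by simp
qed

lemma AE_snd_ne: "AE x in (lborel :: (real \<times> real) measure). snd x \<noteq> a"
proof -
  have "negligible {x :: real \<times> real. x \<bullet> (0, 1) = a}"
    by (rule negligible_standard_hyperplane) (simp add: Basis_prod_def)
  then have "AE x in lebesgue. x \<notin> {x :: real \<times> real. x \<bullet> (0, 1) = a}"
    by (intro AE_not_in) (simp add: negligible_iff_null_sets)
  then show ?thesis unfolding AE_completion_iff by (simp add: inner_prod_def)
qed

text \<open>
  The windows exhaust all offsets except \<open>0\<close>, where the excess vanishes, and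
  \<open>\<plusminus> L / 2\<close>, which are null. The excess itself dominates, as it is
  nonnegative.
\<close>

lemma integral_excess_window_tendsto:
  assumes ex: "integrable lborel excess"
  shows "((\<lambda>e. LINT x|lborel. excess x * indicator (window e) (snd x)) \<longlongrightarrow>
      (LINT x|lborel. excess x)) (at_right 0)"
proof (rule tendsto_lebesgue_integral_at_right_0[of 1 _ excess])
  show "(\<lambda>x. excess x * indicator (window e) (snd x)) \<in> borel_measurable lborel" for e
    using excess_window_measurable by simp
  show "AE x in lborel. norm (excess x * indicator (window e) (snd x)) \<le> excess x" for e
    using excess_nonneg by (intro AE_I2) (auto simp: indicator_def)
  show "AE x in lborel. ((\<lambda>e. excess x * indicator (window e) (snd x)) \<longlongrightarrow>
      excess x) (at_right 0)"
    using AE_snd_ne[of "L / 2"] AE_snd_ne[of "- (L / 2)"]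
  proof eventually_elim
    case (elim x)
    show ?case
    proof (cases "snd x \<noteq> 0 \<and> \<bar>snd x\<bar> < L / 2")
      case True
      define d where "d = min \<bar>snd x\<bar> (L / 2 - \<bar>snd x\<bar>)"
      have d: "0 < d" using True by (simp add: d_def)
      have "\<forall>\<^sub>F e in at_right 0. excess x = excess x * indicator (window e) (snd x)"
      proof (rule eventually_at_rightI[OF _ d])
        fix e assume "e \<in> {0<..<d}"
        then have "snd x \<in> window e" by (auto simp: d_def window_def abs_if split: if_splits)
        then show "excess x = excess x * indicator (window e) (snd x)" by simp
      qed
      then show ?thesis by (rule Lim_transform_eventually[OF tendsto_const])
    next
      case False
      then have "excess x = 0" using elim
          by (auto simp: excess_def indicator_def mem_Times_iff abs_if split: if_splits)
      then show ?thesis by simp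
    qed
  qed
qed (use ex in auto)

text \<open>
  Each window is a pair of intervals, so four boundary terms arise. By their symmetry two of them
  remain, one near the diagonal and one near the antipode.
\<close>

lemma truncated_density_integral:
  assumes e: "0 < e" "e < L / 4"
  shows "truncated_integral_exists L (\<lambda>s x. M1 \<Phi> f s x
      + M2 \<Phi> f s x) e" (is "truncated_integral_exists L ?M e")
    and "truncated_integral L (\<lambda>s x. M1 \<Phi> f s x + M2 \<Phi> f s x) e
      = integral {0..L} (chord_integral e) - 2 * boundary_integral e + 2 * boundary_integral (L / 2 - e)"
proof -
  let ?b = "\<lambda>s. chord_integral e s + (boundary s (- e) - boundary s (- (L / 2 - e))
      + (boundary s (L / 2 - e) - boundary s e))"
  have low: "s - L / 2 + e = s + (e - L / 2)" "s - e = s + - e" "s + L / 2 - e = s + (L / 2 - e)" for s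
    by (simp_all add: algebra_simps)
  have left: "set_integrable lebesgue {s + (e - L / 2)..s + - e} (?M s)"
      "(LINT x:{s + (e - L / 2)..s + - e}|lebesgue. ?M s x) =
        (LINT x:{s + (e - L / 2)..s + - e}|lebesgue. recip (norm (f s - f x)))
            + boundary s (- e) - boundary s (e - L / 2)"
    if "tangent f s = \<tau> s" for s
    by (rule density_integral[OF that]; use e in force)+
  have right: "set_integrable lebesgue {s + e..s + (L / 2 - e)} (?M s)"
      "(LINT x:{s + e..s + (L / 2 - e)}|lebesgue. ?M s x) =
        (LINT x:{s + e..s + (L / 2 - e)}|lebesgue. recip (norm (f s - f x)))
            + boundary s (L / 2 - e) - boundary s e"
    if "tangent f s = \<tau> s" for s
    by (rule density_integral[OF that]; use e in force)+
  have inner: "AE s in lebesgue. inner_truncated_integral L ?M e s = ?b s"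
    using tangent_eq
  proof eventually_elim
    case (elim s)
    show ?case
      unfolding inner_truncated_integral_def low[of s] left(2)[OF elim] right(2)[OF elim]
          chord_integral_eq[OF e] by simp
  qed
  have bm: "(\<lambda>s. boundary s h) \<in> borel_measurable borel" "\<bar>boundary s h\<bar>
      \<le> tail \<Phi> (c * e)"
    if "e \<le> \<bar>h\<bar>" "\<bar>h\<bar> \<le> L / 2" for h s
    using that e by (auto intro!: boundary_measurable boundary_bound)
  have bi: "(\<lambda>s. boundary s h) integrable_on {0..L}" "set_integrable lebesgue {0..L} (\<lambda>s.
      boundary s h)"
    if "e \<le> \<bar>h\<bar>" "\<bar>h\<bar> \<le> L / 2" for h
    using bounded_borel_integrable_on[OF bm[OF that]] bounded_borel_lebesgue(1)[OF bm[OF that]] by auto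
  have ci: "set_integrable lebesgue {0..L} (chord_integral e)"
    by (rule bounded_borel_lebesgue(1)[OF chord_integral_measurable abs_chord_integral_le[OF e(1)]])
  have b1: "set_integrable lebesgue {0..L} (\<lambda>s. boundary s (- e) - boundary s (- (L / 2 - e)))"
    "(LINT s:{0..L}|lebesgue. boundary s (- e) - boundary s (- (L / 2 - e)))
        = boundary_integral (- e) - boundary_integral (- (L / 2 - e))"
    using e by (auto simp: set_lebesgue_integral_eq_integral(2) bi intro!: set_integral_diff)
  have b2: "set_integrable lebesgue {0..L} (\<lambda>s. boundary s (L / 2 - e) - boundary s e)"
    "(LINT s:{0..L}|lebesgue. boundary s (L / 2 - e) - boundary s e)
        = boundary_integral (L / 2 - e) - boundary_integral e"
    using e by (auto simp: set_lebesgue_integral_eq_integral(2) bi intro!: set_integral_diff)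
  have b: "set_integrable lebesgue {0..L} ?b"
    "(LINT s:{0..L}|lebesgue. ?b s) = integral {0..L} (chord_integral e)
      + (boundary_integral (- e) - boundary_integral (- (L / 2 - e))
          + (boundary_integral (L / 2 - e) - boundary_integral e))"
    using set_integral_add[OF ci set_integral_add(1)[OF b1(1) b2(1)]]
    unfolding set_integral_add(2)[OF b1(1) b2(1)] b1(2) b2(2) set_lebesgue_integral_eq_integral(2)[OF ci] .
  have spike: "AE s in lebesgue. s \<in> {0..L} \<longrightarrow> inner_truncated_integral L ?M e s = ?b s"
    using inner by eventually_elim simp
  have "AE s in lebesgue. set_integrable lebesgue {s - L / 2 + e..s - e} (?M s) \<and>
      set_integrable lebesgue {s + e..s + L / 2 - e} (?M s)"
    using tangent_eq
  proof eventually_elim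
    case (elim s)
    show ?case unfolding low[of s] using left(1)[OF elim] right(1)[OF elim] by blast
  qed
  then show "truncated_integral_exists L ?M e"
    unfolding truncated_integral_exists_def using set_integral_spike_AE(1)[OF b(1) spike] by blast
  have "truncated_integral L ?M e = (LINT s:{0..L}|lebesgue. ?b s)"
    unfolding truncated_integral_def by (rule set_integral_spike_AE(2)[OF b(1) spike])
  then show "truncated_integral L ?M e
      = integral {0..L} (chord_integral e) - 2 * boundary_integral e + 2 * boundary_integral (L / 2 - e)"
    using b(2) integral_boundary_minus[of e] integral_boundary_minus[of "L / 2 - e"] e by simp
qed

text \<open>
  At offset \<open>L / 2\<close> the symmetry gives the negative of the integral at \<open>- L /
  2\<close>, while periodicity gives the same value at both. So the integral vanishes there, and it
  depends continuously on the offset.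
\<close>

lemma boundary_integral_half_period:
  "((\<lambda>e. boundary_integral (L / 2 - e)) \<longlongrightarrow> 0) (at_right 0)"
proof -
  have bi: "boundary_integral h = (LINT s|lborel. indicator {0..L} s * boundary s h)"
    if "L / 4 \<le> \<bar>h\<bar>" "\<bar>h\<bar> \<le> L / 2" for h
  proof -
    have "set_integrable lborel {0..L} (\<lambda>s. boundary s h)"
      using that L_pos by (intro bounded_borel_set_integrable[where B
          = "tail \<Phi> (c * (L / 4))"] boundary_measurable boundary_bound) auto
    from set_borel_integral_eq_integral(2)[OF this] show ?thesis by (simp add: set_lebesgue_integral_def)
  qed
  have "boundary s (- (L / 2)) = boundary s (L / 2)" for s
  proof -
    have "s - L / 2 + L = s + L / 2" by simp
    then have "f (s - L / 2) = f (s + L / 2)" using f_periodic[of "s - L / 2"] by (simp only:)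
    then show ?thesis by (simp only: boundary_def diff_conv_add_uminus)
  qed
  then have zero: "boundary_integral (L / 2) = 0"
    using integral_boundary_minus[of "L / 2"] L_pos by simp
  have "((\<lambda>e. LINT s|lborel. indicator {0..L} s * boundary s (L / 2
      - e)) \<longlongrightarrow> (LINT s|lborel. indicator {0..L} s * boundary s (L / 2))) (at_right 0)"
  proof (rule tendsto_lebesgue_integral_at_right_0[of "L / 4" _ "\<lambda>s. indicator {0..L} s * tail
      \<Phi> (c * (L / 4))"])
    have "set_integrable lborel {0..L} (\<lambda>_. tail \<Phi> (c * (L / 4)))"
      by (rule bounded_borel_set_integrable[where B = "\<bar>tail \<Phi> (c * (L / 4))\<bar>"]) auto
    then show "integrable lborel (\<lambda>s. indicator {0..L} s * tail \<Phi> (c * (L / 4)))"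
        by (simp add: set_integrable_def)
    have meas: "(\<lambda>s. indicator {0..L} s * boundary s h) \<in> borel_measurable lborel"
        if "h \<noteq> 0" "\<bar>h\<bar> \<le> L / 2" for h
    proof -
      note boundary_measurable[OF that, measurable]
      show ?thesis by measurable
    qed
    show "(\<lambda>s. indicator {0..L} s * boundary s (L / 2)) \<in> borel_measurable lborel"
        using L_pos by (intro meas) auto
    show "(\<lambda>s. indicator {0..L} s * boundary s (L / 2 - e)) \<in> borel_measurable lborel"
        if "0 < e" "e < L / 4" for e
      using that by (intro meas) auto
    show "AE s in lborel. norm (indicator {0..L} s * boundary s (L / 2 - e))
        \<le> indicator {0..L} s * tail \<Phi> (c * (L / 4))"
      if "0 < e" "e < L / 4" for e
      using that L_pos boundary_bound[of "L / 4" "L / 2 - e"] by (intro AE_I2) (auto simp: indicator_def)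
    show "AE s in lborel. ((\<lambda>e. indicator {0..L} s * boundary s (L / 2
        - e)) \<longlongrightarrow> indicator {0..L} s * boundary s (L / 2)) (at_right 0)"
    proof (intro AE_I2 tendsto_mult_left)
      fix s
      have arg: "((\<lambda>e. L / 2 - e) \<longlongrightarrow> L / 2) (at_right 0)"
          by (auto intro!: tendsto_eq_intros)
      have f: "((\<lambda>e. f (s + (L / 2 - e))) \<longlongrightarrow> f (s + L / 2)) (at_right 0)"
      proof (rule isCont_tendsto_compose[where g = f])
        show "isCont f (s + L / 2)" using f_continuous[of UNIV] by (simp add: continuous_on_eq_continuous_at)
        show "((\<lambda>e. s + (L / 2 - e)) \<longlongrightarrow> s + L / 2) (at_right 0)"
            by (intro tendsto_intros arg)
      qed
      have pos: "0 < norm (f s - f (s + L / 2))" using L_pos by (intro chord_pos) auto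
      have "isCont (Lambda \<Phi>) (norm (f s - f (s + L / 2)))"
        using Lambda_continuous[of "norm (f s - f (s + L / 2)) / 2"] pos
        by (intro continuous_on_interior[where S = "{norm (f s - f (s + L / 2)) / 2..}"]) auto
      then have "((\<lambda>e. Lambda \<Phi> (norm (f s - f (s
          + (L / 2 - e))))) \<longlongrightarrow> Lambda \<Phi> (norm (f s - f (s + L / 2)))) (at_right 0)"
        by (rule isCont_tendsto_compose) (intro tendsto_intros f)
      then show "((\<lambda>e. boundary s (L / 2 - e)) \<longlongrightarrow> boundary s (L / 2)) (at_right 0)"
        unfolding boundary_def by (intro tendsto_intros f)
    qed
  qed (use L_pos in auto)
  then have "((\<lambda>e. LINT s|lborel. indicator {0..L} s * boundary s (L / 2
      - e)) \<longlongrightarrow> 0) (at_right 0)"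
    using bi[of "L / 2"] zero L_pos by simp
  moreover have "\<forall>\<^sub>F e in at_right 0. (LINT s|lborel. indicator {0..L} s * boundary s (L /
      2 - e)) = boundary_integral (L / 2 - e)"
    using L_pos by (intro eventually_at_rightI[of 0 "L / 4"] bi[symmetric]) auto
  ultimately show ?thesis by (rule Lim_transform_eventually)
qed

lemma Lambda_chord_integrable:
  assumes e: "0 < e" "e \<le> L / 2"
  shows "set_integrable lebesgue {0..L} (\<lambda>s. Lambda \<Phi> (norm (f s - f (s + e))))"
  using e Lambda_chord_continuous[of e]
  by (intro set_integrable_lebesgue_of_lborel(1) borel_integrable_atLeastAtMost') (auto intro:
      continuous_on_subset)

text \<open>
  This and the next lemma express the two quantities that tend to \<open>0\<close> by hypothesis
  through the mean of \<open>\<Lambda>\<close> along chords. Eliminating that mean gives the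
  asymptotics of the boundary integral near the diagonal.
\<close>

lemma first_remainder:
  assumes e: "0 < e" "e \<le> L / 2"
  shows "e * (LINT s:{0..L}|lebesgue. Lambda \<Phi> (norm (f s - f (s + e))) - Lambda \<Phi> e)
    = e * (LINT s:{0..L}|lebesgue. Lambda \<Phi> (norm (f s - f (s + e)))) + L * tail \<Phi> e"
proof -
  have const: "set_integrable lebesgue {0..L} (\<lambda>_. Lambda \<Phi> e)"
    by (rule bounded_borel_lebesgue(1)[where B = "\<bar>Lambda \<Phi> e\<bar>"]) auto
  have "(LINT s:{0..L}|lebesgue. Lambda \<Phi> e) = L * Lambda \<Phi> e"
    using set_lebesgue_integral_eq_integral(2)[OF const] L_pos by simp
  moreover have "e * Lambda \<Phi> e = - tail \<Phi> e" using e by (simp add: Lambda_eq_tail)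
  then have "e * (L * Lambda \<Phi> e) = - (L * tail \<Phi> e)" by (simp add: mult.left_commute)
  ultimately show ?thesis
    by (simp only: set_integral_diff(2)[OF Lambda_chord_integrable[OF e] const] right_diff_distrib)
qed

text \<open>
  For unit tangents \<open>\<parallel>\<tau> s - \<tau> x\<parallel>\<^sup>2 = 2 - 2 * (\<tau> x
  \<bullet> \<tau> s)\<close>, and integrating \<open>\<tau> x \<bullet> \<tau> s\<close> over
  \<open>x\<close> recovers the chord, hence the boundary term.
\<close>

lemma second_remainder:
  assumes e: "0 < e" "e \<le> L / 2"
  shows "(LINT s:{0..L}|lebesgue. Lambda \<Phi> (norm (f s - f (s + e))) *
      (LINT x:{s..s + e}|lebesgue. (norm (tangent f s - tangent f x))\<^sup>2))
    = 2 * e * (LINT s:{0..L}|lebesgue. Lambda \<Phi> (norm (f s - f (s + e)))) + 2 * boundary_integral e"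
proof -
  have inner: "(LINT x:{s..s + e}|lebesgue. (norm (tangent f s - tangent f x))\<^sup>2)
      = 2 * e + 2 * ((f s - f (s + e)) \<bullet> \<tau> s)"
    if s: "tangent f s = \<tau> s" for s
  proof -
    have se: "s \<le> s + e" using e by simp
    note inc = unit_inner_increment[OF f_lipschitz se AE_completion[OF \<tau>_derivative], of "\<tau> s"]
    have const: "set_integrable lebesgue {s..s + e} (\<lambda>_. 2 :: real)"
      by (rule bounded_borel_lebesgue(1)[where B = 2]) auto
    have unit: "\<tau> y \<bullet> \<tau> y = 1" for y using \<tau>_unit[of y] by (simp add: dot_square_norm)
    have two: "set_integrable lebesgue {s..s + e} (\<lambda>x. 2 * (\<tau> x \<bullet> \<tau> s))"
      using inc(1) by simp
    have "AE x in lebesgue. x \<in> {s..s + e} \<longrightarrow>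
        (norm (tangent f s - tangent f x))\<^sup>2 = 2 - 2 * (\<tau> x \<bullet> \<tau> s)"
      using tangent_eq
    proof eventually_elim
      case (elim x)
      show ?case unfolding s elim
        by (simp add: power2_norm_eq_inner inner_diff_left inner_diff_right unit inner_commute[of "\<tau> s"])
    qed
    from set_integral_spike_AE(2)[OF set_integral_diff(1)[OF const two] this]
    have "(LINT x:{s..s + e}|lebesgue. (norm (tangent f s - tangent f x))\<^sup>2)
        = (LINT x:{s..s + e}|lebesgue. 2) - 2 * (LINT x:{s..s + e}|lebesgue. \<tau> x \<bullet> \<tau> s)"
      by (simp add: set_integral_diff(2)[OF const two])
    also have "(LINT x:{s..s + e}|lebesgue. 2 :: real) = 2 * e"
      using set_lebesgue_integral_eq_integral(2)[OF const] e by simp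
    finally show ?thesis unfolding inc(2) by (simp add: inner_diff_left)
  qed
  let ?g = "\<lambda>s. 2 * e * Lambda \<Phi> (norm (f s - f (s + e))) + 2 * boundary s e"
  have bi: "set_integrable lebesgue {0..L} (\<lambda>s. boundary s e)" "(LINT s:{0..L}|lebesgue. boundary
      s e) = boundary_integral e"
    using e bounded_borel_lebesgue[of "\<lambda>s. boundary s e" "tail \<Phi> (c * e)" 0 L]
        boundary_measurable[of e] boundary_bound[of e e] by auto
  have g: "set_integrable lebesgue {0..L} ?g"
    "(LINT s:{0..L}|lebesgue. ?g s) = 2 * e * (LINT s:{0..L}|lebesgue. Lambda \<Phi> (norm (f s - f (s
        + e)))) + 2 * boundary_integral e"
    using set_integral_add[of lebesgue "{0..L}" "\<lambda>s. 2 * e * Lambda \<Phi> (norm (f s - f (s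
        + e)))" "\<lambda>s. 2 * boundary s e"]
      Lambda_chord_integrable[OF e] bi by auto
  have "AE s in lebesgue. s \<in> {0..L} \<longrightarrow> Lambda \<Phi> (norm (f s - f (s + e))) *
      (LINT x:{s..s + e}|lebesgue. (norm (tangent f s - tangent f x))\<^sup>2) = ?g s"
    using tangent_eq
  proof eventually_elim
    case (elim s)
    show ?case unfolding inner[OF elim] boundary_def by (simp add: algebra_simps)
  qed
  from set_integral_spike_AE(2)[OF g(1) this] g(2) show ?thesis by simp
qed

text \<open>
  The truncated integral is the truncated energy plus \<open>2 * L * (tail e - tail (L / 2 -
  e))\<close>, which the energy subtracts, plus the boundary terms. The divergent \<open>2 * L *
  tail e\<close> cancels against the boundary terms near the diagonal, up to the two remainders.
\<close>

theorem energy_principal_value: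
  assumes fin: "energy L \<Phi> f < \<infinity>"
    and lim1: "((\<lambda>e. e * (LINT s:{0..L}|lebesgue. Lambda \<Phi> (norm (f s - f (s
        + e))) - Lambda \<Phi> e)) \<longlongrightarrow> 0) (at_right 0)"
    and lim2: "((\<lambda>e. LINT s:{0..L}|lebesgue. Lambda \<Phi> (norm (f s - f (s + e))) *
        (LINT x:{s..s + e}|lebesgue. (norm (tangent f s
            - tangent f x))\<^sup>2)) \<longlongrightarrow> 0) (at_right 0)"
  shows "has_principal_value L (\<lambda>s x. M1 \<Phi> f s x + M2 \<Phi> f s x)
    (enn2real (energy L \<Phi> f) - 2 * L * tail \<Phi> (L / 2))"
proof -
  let ?M = "\<lambda>s x. M1 \<Phi> f s x + M2 \<Phi> f s x"
  have ex: "integrable lborel excess"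
    using fin by (intro integrableI_nonneg) (auto simp: energy_eq_excess excess_nonneg)
  have E: "(LINT x|lborel. excess x) = enn2real (energy L \<Phi> f)"
    unfolding energy_eq_excess by (rule integral_eq_nn_integral) (auto simp: excess_nonneg)
  let ?J1 = "\<lambda>e. e * (LINT s:{0..L}|lebesgue. Lambda \<Phi> (norm (f s - f (s
      + e))) - Lambda \<Phi> e)"
  let ?J2 = "\<lambda>e. LINT s:{0..L}|lebesgue. Lambda \<Phi> (norm (f s - f (s + e))) *
        (LINT x:{s..s + e}|lebesgue. (norm (tangent f s - tangent f x))\<^sup>2)"
  let ?E = "\<lambda>e. LINT x|lborel. excess x * indicator (window e) (snd x)"
  let ?T = "\<lambda>e. ?E e - 2 * L * tail \<Phi> (L / 2 - e) - ?J2 e + 2 * ?J1 e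
      + 2 * boundary_integral (L / 2 - e)"
  have eq: "?T e = truncated_integral L ?M e" if e: "e \<in> {0<..<L / 4}" for e
  proof -
    have e': "0 < e" "e < L / 4" "e \<le> L / 2" using e by auto
    show ?thesis
      unfolding truncated_density_integral(2)[OF e'(1,2)] integral_excess_window[OF ex e'(1,2)]
        first_remainder[OF e'(1,3)] second_remainder[OF e'(1,3)]
      by (simp add: algebra_simps)
  qed
  have tail: "((\<lambda>e. tail \<Phi> (L / 2 - e)) \<longlongrightarrow> tail \<Phi> (L / 2)) (at_right 0)"
  proof (rule isCont_tendsto_compose[where g = "tail \<Phi>"])
    show "isCont (tail \<Phi>) (L / 2)"
      using tail_continuous[of "L / 4"] L_pos by (intro continuous_on_interior[where S = "{L / 4..}"]) auto
    show "((\<lambda>e. L / 2 - e) \<longlongrightarrow> L / 2) (at_right 0)"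
        by (auto intro!: tendsto_eq_intros)
  qed
  have "(?T \<longlongrightarrow> enn2real (energy L \<Phi> f) - 2 * L * tail \<Phi> (L / 2) - 0
      + 2 * 0 + 2 * 0) (at_right 0)"
    unfolding E[symmetric]
    by (intro tendsto_intros integral_excess_window_tendsto ex tail lim1 lim2 boundary_integral_half_period)
  then have T: "(?T \<longlongrightarrow> enn2real (energy L \<Phi> f)
      - 2 * L * tail \<Phi> (L / 2)) (at_right 0)" by simp
  have "(truncated_integral L ?M \<longlongrightarrow> enn2real (energy L \<Phi> f)
      - 2 * L * tail \<Phi> (L / 2)) (at_right 0)"
    using T by (rule Lim_transform_eventually) (use L_pos eq in \<open>auto intro!:
        eventually_at_rightI[of 0 "L / 4"]\<close>)
  moreover have "\<forall>\<^sub>F e in at_right 0. truncated_integral_exists L ?M e"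
    using L_pos by (intro eventually_at_rightI[of 0 "L / 4"] truncated_density_integral(1)) auto
  ultimately show ?thesis unfolding has_principal_value_def by blast
qed

end

lemma bi_Lipschitz_lower:
  assumes L: "L > 0" and bi: "bi_Lipschitz L f"
  shows "\<exists>c>0. \<forall>s h. \<bar>h\<bar> \<le> L / 2 \<longrightarrow> c * \<bar>h\<bar>
      \<le> norm (f s - f (s + h))"
proof -
  obtain c where "c > 0" "\<And>s t. c * circle_dist L s t \<le> norm (f s - f t)"
    using bi unfolding bi_Lipschitz_def by blast
  then show ?thesis using circle_dist_shift[OF L] by metis
qed

theorem mainTheorem2:
  fixes L :: real and \<Phi> :: "real \<Rightarrow> real" and f :: "real \<Rightarrow> real ^ 'n"
  assumes L_pos: "L > 0"
    and Phi_pos: "\<And>x. x > 0 \<Longrightarrow> \<Phi> x > 0"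
    and Phi_mono: "mono_on {0<..} \<Phi>"
    and Phi_integrable: "\<And>x. x > 0 \<Longrightarrow> set_integrable lebesgue {x..} (\<lambda>t. 1 / \<Phi> t)"
    and finite_energy_regularity:
      "\<And>h :: real \<Rightarrow> real ^ 'n.
         simple_closed_arclength_curve L h \<Longrightarrow> energy L \<Phi> h < \<infinity> \<Longrightarrow>
         h \<in> W_Phi L \<Phi> \<inter> W_one_infinity L \<and> bi_Lipschitz L h"
    and limit_1:
      "\<And>h :: real \<Rightarrow> real ^ 'n.
         h \<in> W_Phi L \<Phi> \<inter> W_one_infinity L \<Longrightarrow> bi_Lipschitz L h \<Longrightarrow>
         (AE s in lebesgue. norm (tangent h s) = 1) \<Longrightarrow>
         ((\<lambda>\<epsilon>. \<epsilon> * (LINT s\<^sub>1:{0..L}|lebesgue.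
                      Lambda \<Phi> (norm (h s\<^sub>1 - h (s\<^sub>1 + \<epsilon>))) - Lambda \<Phi> \<epsilon>)) \<longlongrightarrow> 0) (at_right 0)"
    and limit_2:
      "\<And>h :: real \<Rightarrow> real ^ 'n.
         h \<in> W_Phi L \<Phi> \<inter> W_one_infinity L \<Longrightarrow> bi_Lipschitz L h \<Longrightarrow>
         (AE s in lebesgue. norm (tangent h s) = 1) \<Longrightarrow>
         ((\<lambda>\<epsilon>. LINT s\<^sub>1:{0..L}|lebesgue.
                  Lambda \<Phi> (norm (h s\<^sub>1 - h (s\<^sub>1 + \<epsilon>))) *
                  (LINT s\<^sub>2:{s\<^sub>1..s\<^sub>1 + \<epsilon>}|lebesgue. (norm (tangent h s\<^sub>1 - tangent h s\<^sub>2))\<^sup>2))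
            \<longlongrightarrow> 0) (at_right 0)"
    and f_curve: "simple_closed_arclength_curve L f"
    and f_energy: "energy L \<Phi> f < \<infinity>"
  shows "\<exists>pv. has_principal_value L (\<lambda>s\<^sub>1 s\<^sub>2. M1 \<Phi> f s\<^sub>1 s\<^sub>2 + M2 \<Phi> f s\<^sub>1 s\<^sub>2) pv \<and>
           enn2real (energy L \<Phi> f) = pv + 2 * L * (LINT x:{L/2..}|lebesgue. 1 / \<Phi> x)"
proof -
  have W: "f \<in> W_Phi L \<Phi> \<inter> W_one_infinity L" and bi: "bi_Lipschitz L f"
    using finite_energy_regularity[OF f_curve f_energy] by auto
  have len: "curve_length f a b = ennreal (b - a)" if "a \<le> b" for a b
    using f_curve that by (simp add: simple_closed_arclength_curve_def)
  obtain c where c: "c > 0" "\<And>s h. \<bar>h\<bar> \<le> L / 2 \<Longrightarrow> c * \<bar>h\<bar> \<le> norm (f s - f (s + h))"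
    using bi_Lipschitz_lower[OF L_pos bi] by blast
  obtain \<tau> where \<tau>: "\<tau> \<in> borel_measurable borel" "\<And>s. norm (\<tau> s) = 1"
    "AE s in lborel. (f has_vector_derivative \<tau> s) (at s)"
    using arclength_unit_tangent[OF len] by blast
  interpret bilipschitz_arclength_curve \<Phi> L c f \<tau>
  proof
    show "f (s + L) = f s" for s
      using f_curve by (simp add: simple_closed_arclength_curve_def periodic_def)
  qed (use L_pos Phi_pos Phi_mono Phi_integrable c \<tau> arclength_lipschitz[OF len] in auto)
  have "AE s in lebesgue. norm (tangent f s) = 1"
    using tangent_eq by eventually_elim (simp add: \<tau>_unit)
  note limits = limit_1[OF W bi this] limit_2[OF W bi this]
  show ?thesis
    using energy_principal_value[OF f_energy limits]
    by (intro exI[of _ "enn2real (energy L \<Phi> f) - 2 * L * tail \<Phi> (L / 2)"]) (simp add: tail_def)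
qed

end
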